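(* Let $(X,\tau)$ be a $2$-big-path-flimsy topological space. Then, $X$ is compact, and there exists a unique topology $\tau_{\mathrm H}$ on $X$ finer than $\tau$ such that $(X,\tau_{\mathrm H})$ is a Hausdorff $2$-big-path-flimsy space. Namely, $\tau_{\mathrm H}$ is the topology generated by the big-path-connected components (with respect to $\tau$) of the subsets $X\setminus\{x,y\}$ as $(x,y)$ ranges over all pairs of distinct points of $X$. Furthermore, $(X,\tau)$ and $(X,\tau_{\mathrm H})$ have the same big-path-connected subsets and the same big paths.
   Context: A linear order $(L,<)$ is dense if $|L|\geq 2$ and for all $x<y$ there is $z\in L$ with $x<z<y$; it is order-complete if every non-empty subset with an upper bound has a supremum; it is with ends if it has both a minimum and a maximum. A big interval is a topological space $L$ whose topology is the order topology of a dense order-complete linear order with ends on $L$. A big path on a space $X$ from $x$ to $y$ is a continuous map $\gamma\colon L\to X$, with $L$ a big interval, such that $\gamma(\min L)=x$ and $\gamma(\max L)=y$. A space is big-path-connected if any two of its points are joined by a big path in it (the empty space is big-path-connected). Being joined by a big path is an equivalence relation, whose classes are the big-path-connected components. A topological space $X$ is $2$-big-path-flimsy if $|X|>2$ and if, for any subset $S\subseteq X$, the subspace $X\setminus S$ is big-path-connected whenever $|S|<2$ and is not big-path-connected whenever $|S|=2$. "Compact" means that every open cover has a finite subcover (no Hausdorff assumption). "Finer" is meant in the non-strict sense ($\tau\subseteq\tau_{\mathrm H}$). The topology generated by a family of subsets is the coarsest topology containing that family. *)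

theory Defs
  imports "HOL-Analysis.Analysis"
begin

text \<open>
  A linearly ordered set is a reflexive relation r with \<open>Linear_order r\<close>, its carrier being \<open>Field r\<close>.
  The order is kept as data, since the order topology determines it only up to reversal.
\<close>

abbreviation rel_less :: "'l rel \<Rightarrow> 'l \<Rightarrow> 'l \<Rightarrow> bool" where
  "rel_less r a b \<equiv> (a, b) \<in> r \<and> a \<noteq> b"

definition dense_rel :: "'l rel \<Rightarrow> bool" where
  "dense_rel r \<longleftrightarrow> (\<exists>a \<in> Field r. \<exists>b \<in> Field r. a \<noteq> b) \<and>
     (\<forall>a b. rel_less r a b \<longrightarrow> (\<exists>c. rel_less r a c \<and> rel_less r c b))"

definition is_supremum :: "'l rel \<Rightarrow> 'l set \<Rightarrow> 'l \<Rightarrow> bool" where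
  "is_supremum r S u \<longleftrightarrow> u \<in> Field r \<and> (\<forall>s \<in> S. (s, u) \<in> r) \<and>
     (\<forall>v \<in> Field r. (\<forall>s \<in> S. (s, v) \<in> r) \<longrightarrow> (u, v) \<in> r)"

definition order_complete_rel :: "'l rel \<Rightarrow> bool" where
  "order_complete_rel r \<longleftrightarrow>
     (\<forall>S \<subseteq> Field r. S \<noteq> {} \<and> (\<exists>b \<in> Field r. \<forall>s \<in> S. (s, b) \<in> r) \<longrightarrow> (\<exists>u. is_supremum r S u))"

definition is_minimum :: "'l rel \<Rightarrow> 'l \<Rightarrow> bool" where
  "is_minimum r m \<longleftrightarrow> m \<in> Field r \<and> (\<forall>t \<in> Field r. (m, t) \<in> r)"

definition is_maximum :: "'l rel \<Rightarrow> 'l \<Rightarrow> bool" where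
  "is_maximum r m \<longleftrightarrow> m \<in> Field r \<and> (\<forall>t \<in> Field r. (t, m) \<in> r)"

definition big_interval :: "'l rel \<Rightarrow> bool" where
  "big_interval r \<longleftrightarrow> Linear_order r \<and> dense_rel r \<and> order_complete_rel r \<and>
     (\<exists>m. is_minimum r m) \<and> (\<exists>m. is_maximum r m)"

definition min_of :: "'l rel \<Rightarrow> 'l" where
  "min_of r = (THE m. is_minimum r m)"

definition max_of :: "'l rel \<Rightarrow> 'l" where
  "max_of r = (THE m. is_maximum r m)"

definition order_topology_of :: "'l rel \<Rightarrow> 'l topology" where
  "order_topology_of r = topology_generated_by
     ({Field r} \<union> underS r ` Field r \<union> aboveS r ` Field r)"

definition big_path :: "'a topology \<Rightarrow> 'l rel \<Rightarrow> ('l \<Rightarrow> 'a) \<Rightarrow> 'a \<Rightarrow> 'a \<Rightarrow> bool" where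
  "big_path X r \<gamma> x y \<longleftrightarrow> big_interval r \<and> continuous_map (order_topology_of r) X \<gamma> \<and>
     \<gamma> (min_of r) = x \<and> \<gamma> (max_of r) = y"

text \<open>
  Being joined by a big path quantifies over big intervals of arbitrary size, whereas a HOL formula
  can only quantify over big intervals living on a fixed type. The type \<open>'a set list set\<close> is large
  enough for spaces on \<open>'a\<close>: by theorem \<open>big_path_joined_if_big_path\<close> below, two points joined by a
  big path whose interval lives on any type whatsoever are joined in the sense of this definition.
\<close>

definition big_path_joined :: "'a topology \<Rightarrow> 'a \<Rightarrow> 'a \<Rightarrow> bool" where
  "big_path_joined X x y \<longleftrightarrow>
     (\<exists>(r :: 'a set list set rel) (\<gamma> :: 'a set list set \<Rightarrow> 'a). big_path X r \<gamma> x y)"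

definition big_path_connected_space :: "'a topology \<Rightarrow> bool" where
  "big_path_connected_space X \<longleftrightarrow> (\<forall>x \<in> topspace X. \<forall>y \<in> topspace X. big_path_joined X x y)"

definition big_path_connectedin :: "'a topology \<Rightarrow> 'a set \<Rightarrow> bool" where
  "big_path_connectedin X S \<longleftrightarrow> S \<subseteq> topspace X \<and> big_path_connected_space (subtopology X S)"

definition big_path_components_of :: "'a topology \<Rightarrow> 'a set set" where
  "big_path_components_of X = topspace X // {(x, y). big_path_joined X x y}"

definition two_big_path_flimsy :: "'a topology \<Rightarrow> bool" where
  "two_big_path_flimsy X \<longleftrightarrow>
     (infinite (topspace X) \<or> card (topspace X) > 2) \<and>
     (\<forall>S \<subseteq> topspace X.
        (finite S \<and> card S < 2 \<longrightarrow> big_path_connectedin X (topspace X - S)) \<and>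
        (finite S \<and> card S = 2 \<longrightarrow> \<not> big_path_connectedin X (topspace X - S)))"

definition finer_topology :: "'a topology \<Rightarrow> 'a topology \<Rightarrow> bool" where
  "finer_topology Y X \<longleftrightarrow> topspace Y = topspace X \<and> (\<forall>U. openin X U \<longrightarrow> openin Y U)"

text \<open>
  The underlying set is included among the generators because \<open>topology_generated_by\<close> takes the
  union of the generators as the space.
\<close>

definition component_topology :: "'a topology \<Rightarrow> 'a topology" where
  "component_topology X = topology_generated_by (insert (topspace X)
     {C. \<exists>x \<in> topspace X. \<exists>y \<in> topspace X. x \<noteq> y \<and>
           C \<in> big_path_components_of (subtopology X (topspace X - {x, y}))})"


section \<open>Big intervals on arbitrary types\<close>

lemma linear_rel_facts:
  assumes "Linear_order r"
  shows "\<And>a. a \<in> Field r \<Longrightarrow> (a, a) \<in> r"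
    and "\<And>a b c. (a, b) \<in> r \<Longrightarrow> (b, c) \<in> r \<Longrightarrow> (a, c) \<in> r"
    and "\<And>a b. (a, b) \<in> r \<Longrightarrow> (b, a) \<in> r \<Longrightarrow> a = b"
    and "\<And>a b. a \<in> Field r \<Longrightarrow> b \<in> Field r \<Longrightarrow> (a, b) \<in> r \<or> (b, a) \<in> r"
    and "\<And>a b. (a, b) \<in> r \<Longrightarrow> a \<in> Field r \<and> b \<in> Field r"
proof -
  have R: "refl_on (Field r) r" and T: "trans r" and A: "antisym r" and Tot: "total_on (Field r) r"
    using assms unfolding order_on_defs by auto
  show r1: "\<And>a. a \<in> Field r \<Longrightarrow> (a, a) \<in> r" using R by (simp add: refl_on_def)
  show "\<And>a b c. (a, b) \<in> r \<Longrightarrow> (b, c) \<in> r \<Longrightarrow> (a, c) \<in> r" using T by (meson transD)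
  show "\<And>a b. (a, b) \<in> r \<Longrightarrow> (b, a) \<in> r \<Longrightarrow> a = b" using A by (meson antisymD)
  show "\<And>a b. a \<in> Field r \<Longrightarrow> b \<in> Field r \<Longrightarrow> (a, b) \<in> r \<or> (b, a) \<in> r"
    using Tot r1 unfolding total_on_def by metis
  show "\<And>a b. (a, b) \<in> r \<Longrightarrow> a \<in> Field r \<and> b \<in> Field r" by (auto simp: Field_def)
qed

lemma min_of_eq: "Linear_order r \<Longrightarrow> is_minimum r m \<Longrightarrow> min_of r = m"
  unfolding min_of_def
  by (rule the_equality) (auto simp: is_minimum_def intro: linear_rel_facts(3))

lemma max_of_eq: "Linear_order r \<Longrightarrow> is_maximum r m \<Longrightarrow> max_of r = m"
  unfolding max_of_def
  by (rule the_equality) (auto simp: is_maximum_def intro: linear_rel_facts(3))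

definition left_nbhd :: "'l rel \<Rightarrow> ('l \<Rightarrow> bool) \<Rightarrow> 'l \<Rightarrow> bool" where
  "left_nbhd r P t \<longleftrightarrow> (\<forall>a. \<not> rel_less r a t) \<or>
     (\<exists>a. rel_less r a t \<and> (\<forall>z. rel_less r a z \<longrightarrow> (z, t) \<in> r \<longrightarrow> P z))"

definition right_nbhd :: "'l rel \<Rightarrow> ('l \<Rightarrow> bool) \<Rightarrow> 'l \<Rightarrow> bool" where
  "right_nbhd r P t \<longleftrightarrow> (\<forall>a. \<not> rel_less r t a) \<or>
     (\<exists>a. rel_less r t a \<and> (\<forall>z. rel_less r z a \<longrightarrow> (t, z) \<in> r \<longrightarrow> P z))"

lemma topspace_order_topology_of: "topspace (order_topology_of r) = Field r"
  unfolding order_topology_of_def topology_generated_by_topspace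
  by (auto simp: underS_def aboveS_def Field_def)

lemma openin_order_topology_of:
  assumes lin: "Linear_order r"
  shows "openin (order_topology_of r) V \<longleftrightarrow>
    V \<subseteq> Field r \<and> (\<forall>t \<in> V. left_nbhd r (\<lambda>z. z \<in> V) t \<and> right_nbhd r (\<lambda>z. z \<in> V) t)"
    (is "?L \<longleftrightarrow> ?R")
proof
  note L = linear_rel_facts[OF lin]
  let ?S = "{Field r} \<union> underS r ` Field r \<union> aboveS r ` Field r"
  assume ?L
  then have g: "generate_topology_on ?S V"
    unfolding order_topology_of_def by (rule openin_topology_generated_by)
  have sub: "V \<subseteq> Field r"
    using openin_subset[OF \<open>?L\<close>] topspace_order_topology_of by metis
  have "\<forall>t \<in> V. left_nbhd r (\<lambda>z. z \<in> V) t \<and> right_nbhd r (\<lambda>z. z \<in> V) t"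
    using g
  proof (induction rule: generate_topology_on.induct)
    case Empty
    then show ?case by simp
  next
    case (Int A B)
    show ?case
    proof (intro ballI conjI)
      fix t assume t: "t \<in> A \<inter> B"
      have l: "left_nbhd r (\<lambda>z. z \<in> A) t" "left_nbhd r (\<lambda>z. z \<in> B) t"
        and rr: "right_nbhd r (\<lambda>z. z \<in> A) t" "right_nbhd r (\<lambda>z. z \<in> B) t"
        using Int t by auto
      show "left_nbhd r (\<lambda>z. z \<in> A \<inter> B) t"
      proof (cases "\<forall>a. \<not> rel_less r a t")
        case True
        then show ?thesis by (simp add: left_nbhd_def)
      next
        case False
        obtain a where a: "rel_less r a t" "\<forall>z. rel_less r a z \<longrightarrow> (z, t) \<in> r \<longrightarrow> z \<in> A"
          using l(1) False unfolding left_nbhd_def by auto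
        obtain b where b: "rel_less r b t" "\<forall>z. rel_less r b z \<longrightarrow> (z, t) \<in> r \<longrightarrow> z \<in> B"
          using l(2) False unfolding left_nbhd_def by auto
        have "(a, b) \<in> r \<or> (b, a) \<in> r" using a b L by blast
        then show ?thesis
        proof
          assume "(a, b) \<in> r"
          then have "\<forall>z. rel_less r b z \<longrightarrow> (z, t) \<in> r \<longrightarrow> z \<in> A \<inter> B"
            using a b L(2,3) by (metis IntI)
          then show ?thesis using b(1) unfolding left_nbhd_def by blast
        next
          assume "(b, a) \<in> r"
          then have "\<forall>z. rel_less r a z \<longrightarrow> (z, t) \<in> r \<longrightarrow> z \<in> A \<inter> B"
            using a b L(2,3) by (metis IntI)
          then show ?thesis using a(1) unfolding left_nbhd_def by blast
        qed
      qed
      show "right_nbhd r (\<lambda>z. z \<in> A \<inter> B) t"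
      proof (cases "\<forall>a. \<not> rel_less r t a")
        case True
        then show ?thesis by (simp add: right_nbhd_def)
      next
        case False
        obtain a where a: "rel_less r t a" "\<forall>z. rel_less r z a \<longrightarrow> (t, z) \<in> r \<longrightarrow> z \<in> A"
          using rr(1) False unfolding right_nbhd_def by auto
        obtain b where b: "rel_less r t b" "\<forall>z. rel_less r z b \<longrightarrow> (t, z) \<in> r \<longrightarrow> z \<in> B"
          using rr(2) False unfolding right_nbhd_def by auto
        have "(a, b) \<in> r \<or> (b, a) \<in> r" using a b L by blast
        then show ?thesis
        proof
          assume "(a, b) \<in> r"
          then have "\<forall>z. rel_less r z a \<longrightarrow> (t, z) \<in> r \<longrightarrow> z \<in> A \<inter> B"
            using a b L(2,3) by (metis IntI)
          then show ?thesis using a(1) unfolding right_nbhd_def by blast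
        next
          assume "(b, a) \<in> r"
          then have "\<forall>z. rel_less r z b \<longrightarrow> (t, z) \<in> r \<longrightarrow> z \<in> A \<inter> B"
            using a b L(2,3) by (metis IntI)
          then show ?thesis using b(1) unfolding right_nbhd_def by blast
        qed
      qed
    qed
  next
    case (UN K)
    show ?case
    proof (intro ballI)
      fix t assume "t \<in> \<Union>K"
      then obtain k where k: "k \<in> K" "t \<in> k" by auto
      then have "left_nbhd r (\<lambda>z. z \<in> k) t \<and> right_nbhd r (\<lambda>z. z \<in> k) t" using UN by auto
      then show "left_nbhd r (\<lambda>z. z \<in> \<Union>K) t \<and> right_nbhd r (\<lambda>z. z \<in> \<Union>K) t"
        using k(1) unfolding left_nbhd_def right_nbhd_def by (meson UnionI)
    qed
  next
    case (Basis s)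
    then consider "s = Field r" | a where "s = underS r a" | a where "s = aboveS r a" by auto
    then show ?case
    proof cases
      case 1
      then show ?thesis using L(5) unfolding left_nbhd_def right_nbhd_def by blast
    next
      case 2
      have "left_nbhd r (\<lambda>z. z \<in> s) t \<and> right_nbhd r (\<lambda>z. z \<in> s) t" if "t \<in> s" for t
      proof
        have t: "rel_less r t a" using that 2 by (auto simp: underS_def)
        have "z \<in> s" if "(z, t) \<in> r" for z
          using t that L(2,3) 2 unfolding underS_def by blast
        then show "left_nbhd r (\<lambda>z. z \<in> s) t" unfolding left_nbhd_def by blast
        show "right_nbhd r (\<lambda>z. z \<in> s) t"
          using t 2 unfolding right_nbhd_def underS_def by blast
      qed
      then show ?thesis by blast
    next
      case 3
      have "left_nbhd r (\<lambda>z. z \<in> s) t \<and> right_nbhd r (\<lambda>z. z \<in> s) t" if "t \<in> s" for t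
      proof
        have t: "rel_less r a t" using that 3 by (auto simp: aboveS_def)
        have "z \<in> s" if "(t, z) \<in> r" for z
          using t that L(2,3) 3 unfolding aboveS_def by blast
        then show "right_nbhd r (\<lambda>z. z \<in> s) t" unfolding right_nbhd_def by blast
        show "left_nbhd r (\<lambda>z. z \<in> s) t"
          using t 3 unfolding left_nbhd_def aboveS_def by blast
      qed
      then show ?thesis by blast
    qed
  qed
  then show ?R using sub by simp
next
  note L = linear_rel_facts[OF lin]
  let ?S = "{Field r} \<union> underS r ` Field r \<union> aboveS r ` Field r"
  assume R: ?R
  have op: "openin (order_topology_of r) W" if "W \<in> ?S" for W
    unfolding order_topology_of_def by (rule topology_generated_by_Basis[OF that])
  show ?L
  proof (subst openin_subopen, intro ballI)
    fix t assume t: "t \<in> V"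
    have tF: "t \<in> Field r" using R t by auto
    obtain A where A: "openin (order_topology_of r) A" "t \<in> A" "\<forall>z \<in> A. (z, t) \<in> r \<longrightarrow> z \<in> V"
    proof (cases "\<forall>a. \<not> rel_less r a t")
      case True
      then have "\<forall>z \<in> Field r. (z, t) \<in> r \<longrightarrow> z \<in> V" using t by auto
      then show ?thesis using that[of "Field r"] op tF by auto
    next
      case False
      then obtain a where a: "rel_less r a t" "\<forall>z. rel_less r a z \<longrightarrow> (z, t) \<in> r \<longrightarrow> z \<in> V"
        using R t unfolding left_nbhd_def by auto
      have "a \<in> Field r" using a L(5) by blast
      then show ?thesis using that[of "aboveS r a"] op a unfolding aboveS_def by blast
    qed
    obtain B where B: "openin (order_topology_of r) B" "t \<in> B" "\<forall>z \<in> B. (t, z) \<in> r \<longrightarrow> z \<in> V"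
    proof (cases "\<forall>a. \<not> rel_less r t a")
      case True
      then have "\<forall>z \<in> Field r. (t, z) \<in> r \<longrightarrow> z \<in> V" using t by auto
      then show ?thesis using that[of "Field r"] op tF by auto
    next
      case False
      then obtain a where a: "rel_less r t a" "\<forall>z. rel_less r z a \<longrightarrow> (t, z) \<in> r \<longrightarrow> z \<in> V"
        using R t unfolding right_nbhd_def by auto
      have "a \<in> Field r" using a L(5) by blast
      then show ?thesis using that[of "underS r a"] op a unfolding underS_def by blast
    qed
    have "A \<inter> B \<subseteq> V"
    proof
      fix z assume z: "z \<in> A \<inter> B"
      then have "z \<in> Field r"
        using openin_subset[OF A(1)] by (auto simp: topspace_order_topology_of)
      then show "z \<in> V" using L(4)[of z t] z tF A B by blast
    qed
    then show "\<exists>T. openin (order_topology_of r) T \<and> t \<in> T \<and> T \<subseteq> V"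
      using A B by (intro exI[of _ "A \<inter> B"]) auto
  qed
qed

lemma continuous_map_order_topology_of:
  assumes lin: "Linear_order r"
  shows "continuous_map (order_topology_of r) X \<gamma> \<longleftrightarrow>
    (\<forall>t \<in> Field r. \<gamma> t \<in> topspace X) \<and>
    (\<forall>U t. openin X U \<longrightarrow> t \<in> Field r \<longrightarrow> \<gamma> t \<in> U \<longrightarrow>
       left_nbhd r (\<lambda>z. \<gamma> z \<in> U) t \<and> right_nbhd r (\<lambda>z. \<gamma> z \<in> U) t)"
proof -
  note L = linear_rel_facts[OF lin]
  have eqs: "left_nbhd r (\<lambda>z. z \<in> {x \<in> Field r. \<gamma> x \<in> U}) t \<longleftrightarrow> left_nbhd r (\<lambda>z. \<gamma> z \<in> U) t"
    "right_nbhd r (\<lambda>z. z \<in> {x \<in> Field r. \<gamma> x \<in> U}) t \<longleftrightarrow> right_nbhd r (\<lambda>z. \<gamma> z \<in> U) t" for U t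
  proof -
    have "(rel_less r a z \<longrightarrow> (z, t) \<in> r \<longrightarrow> z \<in> {x \<in> Field r. \<gamma> x \<in> U}) \<longleftrightarrow>
        (rel_less r a z \<longrightarrow> (z, t) \<in> r \<longrightarrow> \<gamma> z \<in> U)"
      "(rel_less r z a \<longrightarrow> (t, z) \<in> r \<longrightarrow> z \<in> {x \<in> Field r. \<gamma> x \<in> U}) \<longleftrightarrow>
        (rel_less r z a \<longrightarrow> (t, z) \<in> r \<longrightarrow> \<gamma> z \<in> U)" for a z
      using L(5)[of z t] L(5)[of t z] by blast+
    then show "left_nbhd r (\<lambda>z. z \<in> {x \<in> Field r. \<gamma> x \<in> U}) t \<longleftrightarrow> left_nbhd r (\<lambda>z. \<gamma> z \<in> U) t"
      "right_nbhd r (\<lambda>z. z \<in> {x \<in> Field r. \<gamma> x \<in> U}) t \<longleftrightarrow> right_nbhd r (\<lambda>z. \<gamma> z \<in> U) t"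
      unfolding left_nbhd_def right_nbhd_def by presburger+
  qed
  show ?thesis
    unfolding continuous_map topspace_order_topology_of openin_order_topology_of[OF lin] eqs
    by auto
qed

lemma closure_card_le:
  includes cardinal_syntax
  fixes G :: "'i \<Rightarrow> 'l \<Rightarrow> 'l \<Rightarrow> 'l set" and K :: "'k set"
  assumes inf: "infinite K" and I: "|UNIV :: 'i set| \<le>o |K|" and fin: "\<And>i s t. finite (G i s t)"
    and fin0: "finite D0" and D0: "D0 \<subseteq> F"
    and cl: "\<And>i s t. s \<in> F \<Longrightarrow> t \<in> F \<Longrightarrow> G i s t \<subseteq> F"
  shows "\<exists>D. D0 \<subseteq> D \<and> D \<subseteq> F \<and> |D| \<le>o |K| \<and> (\<forall>i. \<forall>s \<in> D. \<forall>t \<in> D. G i s t \<subseteq> D)"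
proof -
  define step where "step D = D \<union> (\<Union>p \<in> D \<times> D. \<Union>i. G i (fst p) (snd p))" for D
  define E where "E n = (step ^^ n) D0" for n
  have E0: "E 0 = D0" and ES: "E (Suc n) = step (E n)" for n by (simp_all add: E_def)
  have finK: "|A| \<le>o |K|" if "finite A" for A :: "'l set"
    using that inf card_of_ordLeq_finite ordLeq_total card_of_Well_order by meson
  have cardE: "|E n| \<le>o |K|" for n
  proof (induction n)
    case 0
    then show ?case using finK fin0 E0 by simp
  next
    case (Suc n)
    have "|\<Union>i. G i (fst p) (snd p)| \<le>o |K|" for p
      by (rule card_of_UNION_ordLeq_infinite[OF inf I]) (simp add: finK fin)
    moreover have "|E n \<times> E n| \<le>o |K|"
      using Suc inf
      by (intro card_of_Times_ordLeq_infinite_Field) (auto simp: card_of_card_order_on Field_card_of)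
    ultimately have "|\<Union>p \<in> E n \<times> E n. \<Union>i. G i (fst p) (snd p)| \<le>o |K|"
      by (intro card_of_UNION_ordLeq_infinite[OF inf]) auto
    then show ?case
      unfolding ES step_def using Suc inf
      by (intro card_of_Un_ordLeq_infinite_Field) (auto simp: card_of_card_order_on Field_card_of)
  qed
  have EF: "E n \<subseteq> F" for n
  proof (induction n)
    case 0
    then show ?case using E0 D0 by simp
  next
    case (Suc n)
    have "G i a b \<subseteq> F" if "a \<in> E n" "b \<in> E n" for i a b
      using cl[of a b i] Suc that by blast
    then show ?case unfolding ES step_def using Suc by force
  qed
  have mono: "E n \<subseteq> E (n + k)" for n k
    by (induction k) (auto simp: ES step_def)
  have "|UNIV :: nat set| \<le>o |K|" using inf infinite_iff_card_of_nat by blast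
  then have card: "|\<Union>n. E n| \<le>o |K|"
    using cardE by (intro card_of_UNION_ordLeq_infinite[OF inf]) auto
  have "G i s t \<subseteq> (\<Union>n. E n)" if s: "s \<in> (\<Union>n. E n)" and t: "t \<in> (\<Union>n. E n)" for i s t
  proof -
    obtain n m where "s \<in> E n" "t \<in> E m" using s t by auto
    then have "s \<in> E (n + m)" "t \<in> E (n + m)" using mono[of n m] mono[of m n]
      by (auto simp: add.commute)
    then have "G i s t \<subseteq> E (Suc (n + m))" unfolding ES step_def by force
    then show ?thesis by blast
  qed
  then show ?thesis using card EF E0 by (intro exI[of _ "\<Union>n. E n"]) blast
qed

lemma big_path_transfer:
  assumes bp: "big_path X r \<gamma> x y" and inj: "inj_on e (Field r)"
  shows "big_path X (map_prod e e ` r) (\<gamma> \<circ> inv_into (Field r) e) x y"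
proof -
  have lin: "Linear_order r" and dn: "dense_rel r" and oc: "order_complete_rel r"
    and mn: "\<exists>m. is_minimum r m" and mx: "\<exists>m. is_maximum r m"
    and co: "continuous_map (order_topology_of r) X \<gamma>"
    using bp unfolding big_path_def big_interval_def by auto
  note L = linear_rel_facts[OF lin]
  define Q where "Q = map_prod e e ` r"
  let ?i = "inv_into (Field r) e"
  have F: "Field Q = e ` Field r" unfolding Field_def Q_def by force
  have ie: "?i (e a) = a" if "a \<in> Field r" for a using that inj by simp
  have qq: "(u, v) \<in> Q \<longleftrightarrow> (\<exists>a b. u = e a \<and> v = e b \<and> (a, b) \<in> r)" for u v
  proof
    assume "(u, v) \<in> Q"
    then obtain p where "p \<in> r" "(u, v) = map_prod e e p" unfolding Q_def by (metis imageE)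
    then show "\<exists>a b. u = e a \<and> v = e b \<and> (a, b) \<in> r" by (cases p) auto
  next
    assume "\<exists>a b. u = e a \<and> v = e b \<and> (a, b) \<in> r"
    then obtain a b where "(u, v) = map_prod e e (a, b)" "(a, b) \<in> r" by auto
    then show "(u, v) \<in> Q" unfolding Q_def by (metis image_eqI)
  qed
  have ee: "e a = e b \<longleftrightarrow> a = b" if "a \<in> Field r" "b \<in> Field r" for a b
    using that inj by (simp add: inj_on_eq_iff)
  have q: "(e a, e b) \<in> Q \<longleftrightarrow> (a, b) \<in> r" if "a \<in> Field r" "b \<in> Field r" for a b
    unfolding qq using that ee L(5) by metis
  have lin': "Linear_order Q"
    unfolding order_on_defs
  proof (intro conjI)
    show "Q \<subseteq> Field Q \<times> Field Q" by (auto simp: Field_def)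
    show "refl_on (Field Q) Q" unfolding refl_on_def F using q L(1) by blast
    show "trans Q"
    proof (rule transI)
      fix u v w assume "(u, v) \<in> Q" "(v, w) \<in> Q"
      then obtain a b c d where *: "u = e a" "v = e b" "(a, b) \<in> r" "v = e c" "w = e d" "(c, d) \<in> r"
        unfolding qq by blast
      then have "b = c" using ee L(5) by metis
      then show "(u, w) \<in> Q" using * L(2) qq by metis
    qed
    show "antisym Q"
    proof (rule antisymI)
      fix u v assume "(u, v) \<in> Q" "(v, u) \<in> Q"
      then obtain a b c d where *: "u = e a" "v = e b" "(a, b) \<in> r" "v = e c" "u = e d" "(c, d) \<in> r"
        unfolding qq by blast
      then have "b = c" "a = d" using ee L(5) by metis+
      then show "u = v" using * L(3) by metis
    qed
    show "total_on (Field Q) Q" unfolding total_on_def F using q L(4) by blast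
  qed
  have ls: "rel_less Q (e a) (e b) \<longleftrightarrow> rel_less r a b" if "a \<in> Field r" "b \<in> Field r" for a b
    using q[OF that] ee[OF that] by simp
  have "dense_rel Q"
    unfolding dense_rel_def
  proof (intro conjI allI impI)
    show "\<exists>a \<in> Field Q. \<exists>b \<in> Field Q. a \<noteq> b" using dn ee unfolding F dense_rel_def by blast
    fix u v assume uv: "rel_less Q u v"
    then have "u \<in> Field Q" "v \<in> Field Q" by (auto simp: Field_def)
    then obtain a b where ab: "u = e a" "v = e b" "a \<in> Field r" "b \<in> Field r" using F by auto
    then have "rel_less r a b" using uv ls by simp
    then obtain c where c: "rel_less r a c" "rel_less r c b" using dn unfolding dense_rel_def by meson
    then have "c \<in> Field r" using L by blast
    then show "\<exists>c. rel_less Q u c \<and> rel_less Q c v" using c ab ls by metis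
  qed
  moreover have "order_complete_rel Q"
    unfolding order_complete_rel_def
  proof (intro allI impI)
    fix S assume S: "S \<subseteq> Field Q" "S \<noteq> {} \<and> (\<exists>b \<in> Field Q. \<forall>s \<in> S. (s, b) \<in> Q)"
    then obtain T where T: "T \<subseteq> Field r" "S = e ` T" unfolding F by (meson subset_imageE)
    obtain v where v: "v \<in> Field Q" "\<forall>s \<in> S. (s, v) \<in> Q" using S(2) by blast
    then obtain b where b: "b \<in> Field r" "v = e b" using F by auto
    have "(s, b) \<in> r" if "s \<in> T" for s
    proof -
      have "e s \<in> S" "s \<in> Field r" using that T by auto
      then show ?thesis using v(2) b q[of s b] by auto
    qed
    then obtain u where u: "is_supremum r T u"
      using oc T S(2) b(1) unfolding order_complete_rel_def by (metis image_empty)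
    have uF: "u \<in> Field r" using u by (simp add: is_supremum_def)
    have "is_supremum Q S (e u)"
      unfolding is_supremum_def
    proof (intro conjI ballI impI)
      show "e u \<in> Field Q" using uF F by simp
      show "(s, e u) \<in> Q" if s: "s \<in> S" for s
      proof -
        obtain a where "a \<in> T" "s = e a" using s T by auto
        then show ?thesis using u qq unfolding is_supremum_def by blast
      qed
      fix v assume v: "v \<in> Field Q" "\<forall>s \<in> S. (s, v) \<in> Q"
      then obtain w where w: "v = e w" "w \<in> Field r" using F by auto
      have "(s, w) \<in> r" if "s \<in> T" for s
      proof -
        have "e s \<in> S" "s \<in> Field r" using that T by auto
        then show ?thesis using v(2) w q[of s w] by auto
      qed
      then show "(e u, v) \<in> Q" using u w q uF unfolding is_supremum_def by blast
    qed
    then show "\<exists>u. is_supremum Q S u" by blast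
  qed
  moreover obtain m where m: "is_minimum r m" using mn by blast
  moreover have m': "is_minimum Q (e m)"
    using m q unfolding is_minimum_def F by auto
  moreover obtain M where M: "is_maximum r M" using mx by blast
  moreover have M': "is_maximum Q (e M)"
    using M q unfolding is_maximum_def F by auto
  ultimately have bi: "big_interval Q" using lin' unfolding big_interval_def by blast
  have ends: "(\<gamma> \<circ> ?i) (min_of Q) = x" "(\<gamma> \<circ> ?i) (max_of Q) = y"
    using bp min_of_eq[OF lin m] min_of_eq[OF lin' m'] max_of_eq[OF lin M] max_of_eq[OF lin' M'] ie m M
    unfolding big_path_def is_minimum_def is_maximum_def by auto
  have ex: "(\<exists>u. rel_less Q u (e t) \<and> P u) \<longleftrightarrow> (\<exists>a. rel_less r a t \<and> P (e a))"
    "(\<exists>u. rel_less Q (e t) u \<and> P u) \<longleftrightarrow> (\<exists>a. rel_less r t a \<and> P (e a))"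
    if t: "t \<in> Field r" for t P
  proof -
    have "rel_less Q u (e t) \<longleftrightarrow> (\<exists>a. u = e a \<and> rel_less r a t)"
      "rel_less Q (e t) u \<longleftrightarrow> (\<exists>a. u = e a \<and> rel_less r t a)" for u
    proof -
      have a: "a = t" if "e a = e t" "a \<in> Field r" for a using ee that t by simp
      have "(u, e t) \<in> Q \<longleftrightarrow> (\<exists>a. u = e a \<and> (a, t) \<in> r)"
        "(e t, u) \<in> Q \<longleftrightarrow> (\<exists>a. u = e a \<and> (t, a) \<in> r)"
        unfolding qq using a L(5) by metis+
      moreover have "e a = e t \<longleftrightarrow> a = t" if "(a, t) \<in> r \<or> (t, a) \<in> r" for a
        using that L(5) ee t by blast
      ultimately show "rel_less Q u (e t) \<longleftrightarrow> (\<exists>a. u = e a \<and> rel_less r a t)"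
        "rel_less Q (e t) u \<longleftrightarrow> (\<exists>a. u = e a \<and> rel_less r t a)" by auto
    qed
    then show "(\<exists>u. rel_less Q u (e t) \<and> P u) \<longleftrightarrow> (\<exists>a. rel_less r a t \<and> P (e a))"
      "(\<exists>u. rel_less Q (e t) u \<and> P u) \<longleftrightarrow> (\<exists>a. rel_less r t a \<and> P (e a))"
      by auto
  qed
  have nb: "left_nbhd Q (\<lambda>z. (\<gamma> \<circ> ?i) z \<in> U) (e t) \<longleftrightarrow> left_nbhd r (\<lambda>z. \<gamma> z \<in> U) t"
    "right_nbhd Q (\<lambda>z. (\<gamma> \<circ> ?i) z \<in> U) (e t) \<longleftrightarrow> right_nbhd r (\<lambda>z. \<gamma> z \<in> U) t"
    if t: "t \<in> Field r" for t U
  proof -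
    have 1: "(\<forall>z. rel_less Q (e a) z \<longrightarrow> (z, e t) \<in> Q \<longrightarrow> (\<gamma> \<circ> ?i) z \<in> U) \<longleftrightarrow>
          (\<forall>z. rel_less r a z \<longrightarrow> (z, t) \<in> r \<longrightarrow> \<gamma> z \<in> U)" (is "?A \<longleftrightarrow> ?B")
      if "rel_less r a t" for a
    proof -
      have a: "a \<in> Field r" using that L(5) by blast
      show ?thesis
      proof
        assume ?A
        show ?B
        proof (intro allI impI)
          fix z assume z: "rel_less r a z" "(z, t) \<in> r"
          then have zF: "z \<in> Field r" using L(5) by blast
          then have "rel_less Q (e a) (e z)" "(e z, e t) \<in> Q" using z a t ee q by simp_all
          then have "(\<gamma> \<circ> ?i) (e z) \<in> U" using \<open>?A\<close> by blast
          then show "\<gamma> z \<in> U" using ie zF by simp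
        qed
      next
        assume ?B
        show ?A
        proof (intro allI impI)
          fix z assume z: "rel_less Q (e a) z" "(z, e t) \<in> Q"
          then have "z \<in> Field Q" by (auto simp: Field_def)
          then obtain w where w: "z = e w" "w \<in> Field r" using F by auto
          then have "rel_less r a w" "(w, t) \<in> r" using z a t ee q by simp_all
          then show "(\<gamma> \<circ> ?i) z \<in> U" using \<open>?B\<close> w ie by simp
        qed
      qed
    qed
    have 2: "(\<forall>z. rel_less Q z (e a) \<longrightarrow> (e t, z) \<in> Q \<longrightarrow> (\<gamma> \<circ> ?i) z \<in> U) \<longleftrightarrow>
          (\<forall>z. rel_less r z a \<longrightarrow> (t, z) \<in> r \<longrightarrow> \<gamma> z \<in> U)" (is "?A \<longleftrightarrow> ?B")
      if "rel_less r t a" for a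
    proof -
      have a: "a \<in> Field r" using that L(5) by blast
      show ?thesis
      proof
        assume ?A
        show ?B
        proof (intro allI impI)
          fix z assume z: "rel_less r z a" "(t, z) \<in> r"
          then have zF: "z \<in> Field r" using L(5) by blast
          then have "rel_less Q (e z) (e a)" "(e t, e z) \<in> Q" using z a t ee q by simp_all
          then have "(\<gamma> \<circ> ?i) (e z) \<in> U" using \<open>?A\<close> by blast
          then show "\<gamma> z \<in> U" using ie zF by simp
        qed
      next
        assume ?B
        show ?A
        proof (intro allI impI)
          fix z assume z: "rel_less Q z (e a)" "(e t, z) \<in> Q"
          then have "z \<in> Field Q" by (auto simp: Field_def)
          then obtain w where w: "z = e w" "w \<in> Field r" using F by auto
          then have "rel_less r w a" "(t, w) \<in> r" using z a t ee q by simp_all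
          then show "(\<gamma> \<circ> ?i) z \<in> U" using \<open>?B\<close> w ie by simp
        qed
      qed
    qed
    have e1: "(\<exists>u. rel_less Q u (e t)) \<longleftrightarrow> (\<exists>a. rel_less r a t)"
      and e2: "(\<exists>u. rel_less Q (e t) u) \<longleftrightarrow> (\<exists>a. rel_less r t a)"
      using ex[OF t, of "\<lambda>_. True"] by simp_all
    show "left_nbhd Q (\<lambda>z. (\<gamma> \<circ> ?i) z \<in> U) (e t) \<longleftrightarrow> left_nbhd r (\<lambda>z. \<gamma> z \<in> U) t"
      unfolding left_nbhd_def
      using e1 ex(1)[OF t, of "\<lambda>u. \<forall>z. rel_less Q u z \<longrightarrow> (z, e t) \<in> Q \<longrightarrow> (\<gamma> \<circ> ?i) z \<in> U"] 1
      by meson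
    show "right_nbhd Q (\<lambda>z. (\<gamma> \<circ> ?i) z \<in> U) (e t) \<longleftrightarrow> right_nbhd r (\<lambda>z. \<gamma> z \<in> U) t"
      unfolding right_nbhd_def
      using e2 ex(2)[OF t, of "\<lambda>u. \<forall>z. rel_less Q z u \<longrightarrow> (e t, z) \<in> Q \<longrightarrow> (\<gamma> \<circ> ?i) z \<in> U"] 2
      by meson
  qed
  have "continuous_map (order_topology_of Q) X (\<gamma> \<circ> ?i)"
    unfolding continuous_map_order_topology_of[OF lin']
  proof (intro conjI allI ballI impI)
    note c = co[unfolded continuous_map_order_topology_of[OF lin]]
    show "(\<gamma> \<circ> ?i) t \<in> topspace X" if "t \<in> Field Q" for t using that c ie unfolding F by auto
    fix U t assume *: "openin X U" "t \<in> Field Q" "(\<gamma> \<circ> ?i) t \<in> U"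
    then obtain a where a: "t = e a" "a \<in> Field r" using F by auto
    then have "left_nbhd r (\<lambda>z. \<gamma> z \<in> U) a \<and> right_nbhd r (\<lambda>z. \<gamma> z \<in> U) a"
      using * c ie by auto
    then show "left_nbhd Q (\<lambda>z. (\<gamma> \<circ> ?i) z \<in> U) t" "right_nbhd Q (\<lambda>z. (\<gamma> \<circ> ?i) z \<in> U) t"
      using nb a by simp_all
  qed
  then show ?thesis using bi ends unfolding big_path_def Q_def by blast
qed

lemma big_path_small_restriction:
  fixes X :: "'a topology" and r :: "'l rel"
  assumes bp: "big_path X r \<gamma> x y"
  obtains q and e :: "'l \<Rightarrow> 'a set list set"
  where "big_path X q \<gamma> x y" "inj_on e (Field q)"
proof -
  have lin: "Linear_order r" and dn: "dense_rel r" and oc: "order_complete_rel r"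
    and mn: "\<exists>m. is_minimum r m" and mx: "\<exists>m. is_maximum r m"
    and co: "continuous_map (order_topology_of r) X \<gamma>"
    using bp unfolding big_path_def big_interval_def by auto
  note L = linear_rel_facts[OF lin]
  note c = co[unfolded continuous_map_order_topology_of[OF lin]]
  obtain m where m: "is_minimum r m" using mn by blast
  obtain M where M: "is_maximum r M" using mx by blast
  have mF: "m \<in> Field r" "\<And>t. t \<in> Field r \<Longrightarrow> (m, t) \<in> r" using m by (auto simp: is_minimum_def)
  have MF: "M \<in> Field r" "\<And>t. t \<in> Field r \<Longrightarrow> (t, M) \<in> r" using M by (auto simp: is_maximum_def)
  have le_less: "rel_less r a b" if "(a, d) \<in> r" "rel_less r d b" for a d b
    using that L(2,3) by metis
  have less_le: "rel_less r a b" if "rel_less r a d" "(d, b) \<in> r" for a d b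
    using that L(2,3) by metis
  have not_le: "rel_less r b a" if "a \<in> Field r" "b \<in> Field r" "(a, b) \<notin> r" for a b
    using that L(1,4) by metis
  define LW where "LW U s a \<longleftrightarrow> rel_less r a s \<and> (\<forall>z. rel_less r a z \<longrightarrow> (z, s) \<in> r \<longrightarrow> \<gamma> z \<in> U)"
    for U s a
  define RW where "RW U s a \<longleftrightarrow> rel_less r s a \<and> (\<forall>z. rel_less r z a \<longrightarrow> (s, z) \<in> r \<longrightarrow> \<gamma> z \<in> U)"
    for U s a
  define run where "run U s = {v. (s, v) \<in> r \<and> (\<forall>z. (s, z) \<in> r \<longrightarrow> (z, v) \<in> r \<longrightarrow> \<gamma> z \<in> U)}"
    for U s
  define BW where "BW s t d \<longleftrightarrow> rel_less r s d \<and> rel_less r d t" for s t d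
  define P where "P U s t W \<longleftrightarrow> ((\<exists>d. BW s t d) \<longrightarrow> (\<exists>d \<in> W. BW s t d)) \<and>
      ((\<exists>a. LW U s a) \<longrightarrow> (\<exists>a \<in> W. LW U s a)) \<and> ((\<exists>a. RW U s a) \<longrightarrow> (\<exists>a \<in> W. RW U s a)) \<and>
      ((\<exists>u. is_supremum r (run U s) u) \<longrightarrow> (\<exists>u \<in> W. is_supremum r (run U s) u))" for U s t W
  have pick: "\<exists>W. finite W \<and> W \<subseteq> Field r \<and> ((\<exists>a. Q a) \<longrightarrow> (\<exists>a \<in> W. Q a))"
    if Q: "\<forall>a. Q a \<longrightarrow> a \<in> Field r" for Q
  proof (cases "\<exists>a. Q a")
    case True
    then obtain a where "Q a" by blast
    then show ?thesis using Q by (intro exI[of _ "{a}"]) auto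
  next
    case False
    then show ?thesis by (intro exI[of _ "{}"]) auto
  qed
  have inF: "BW s t a \<Longrightarrow> a \<in> Field r" "LW U s a \<Longrightarrow> a \<in> Field r" "RW U s a \<Longrightarrow> a \<in> Field r"
    "is_supremum r A a \<Longrightarrow> a \<in> Field r" for s t U a A
    using L(5)[of s a] L(5)[of a s] unfolding BW_def LW_def RW_def is_supremum_def by simp_all
  have ex: "\<exists>W. finite W \<and> W \<subseteq> Field r \<and> P U s t W" for U s t
  proof -
    obtain W1 where W1: "finite W1" "W1 \<subseteq> Field r" "(\<exists>d. BW s t d) \<longrightarrow> (\<exists>d \<in> W1. BW s t d)"
      using pick[of "BW s t"] inF(1) by auto
    obtain W2 where W2: "finite W2" "W2 \<subseteq> Field r" "(\<exists>d. LW U s d) \<longrightarrow> (\<exists>d \<in> W2. LW U s d)"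
      using pick[of "LW U s"] inF(2) by auto
    obtain W3 where W3: "finite W3" "W3 \<subseteq> Field r" "(\<exists>d. RW U s d) \<longrightarrow> (\<exists>d \<in> W3. RW U s d)"
      using pick[of "RW U s"] inF(3) by auto
    obtain W4 where W4: "finite W4" "W4 \<subseteq> Field r"
      "(\<exists>u. is_supremum r (run U s) u) \<longrightarrow> (\<exists>u \<in> W4. is_supremum r (run U s) u)"
      using pick[of "is_supremum r (run U s)"] inF(4) by auto
    have "P U s t (W1 \<union> W2 \<union> W3 \<union> W4)"
      unfolding P_def bex_Un using W1(3) W2(3) W3(3) W4(3) by simp
    then show ?thesis using W1 W2 W3 W4 by (intro exI[of _ "W1 \<union> W2 \<union> W3 \<union> W4"]) simp
  qed
  define G where "G U s t = (SOME W. finite W \<and> W \<subseteq> Field r \<and> P U s t W)" for U s t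
  have G: "finite (G U s t)" "G U s t \<subseteq> Field r" "P U s t (G U s t)" for U s t
    using someI_ex[OF ex[of U s t]] unfolding G_def by auto
  have cardI: "(card_of (UNIV :: 'a set set), card_of (UNIV :: 'a set list set)) \<in> ordLeq"
    by (rule card_of_ordLeqI[of "\<lambda>U. [U]"]) (auto simp: inj_on_def)
  have "\<exists>D. {m, M} \<subseteq> D \<and> D \<subseteq> Field r \<and> (card_of D, card_of (UNIV :: 'a set list set)) \<in> ordLeq \<and>
      (\<forall>U. \<forall>s \<in> D. \<forall>t \<in> D. G U s t \<subseteq> D)"
    by (rule closure_card_le[OF infinite_UNIV_listI cardI G(1)]) (use G(2) mF MF in auto)
  then obtain D where D: "m \<in> D" "M \<in> D" "D \<subseteq> Field r"
    "(card_of D, card_of (UNIV :: 'a set list set)) \<in> ordLeq"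
    and DG: "\<And>U s t. s \<in> D \<Longrightarrow> t \<in> D \<Longrightarrow> G U s t \<subseteq> D"
    by auto
  have PD: "P U s t D" if "s \<in> D" "t \<in> D" for U s t
    using G(3)[of U s t] DG[OF that, of U] unfolding P_def by blast
  have Dbw: "\<exists>d \<in> D. rel_less r s d \<and> rel_less r d t" if st: "s \<in> D" "t \<in> D" "rel_less r s t" for s t
  proof -
    have "\<exists>d. BW s t d" using dn st(3) unfolding dense_rel_def BW_def by blast
    then show ?thesis using PD[OF st(1,2)] unfolding P_def BW_def by blast
  qed
  define C where "C = {s \<in> Field r. s \<notin> D \<and> is_supremum r {d \<in> D. rel_less r d s} s \<and>
      (\<forall>b \<in> D. rel_less r s b \<longrightarrow> (\<exists>b' \<in> D. rel_less r s b' \<and> rel_less r b' b))}"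
  define N where "N = D \<union> C"
  have NF: "N \<subseteq> Field r" using D unfolding N_def C_def by auto
  have Clow: "\<exists>d \<in> D. rel_less r s d \<and> rel_less r d t" if t: "t \<in> C" and s: "rel_less r s t" for s t
  proof (rule ccontr)
    assume no: "\<not> ?thesis"
    have sF: "s \<in> Field r" using s L(5) by blast
    have "(d, s) \<in> r" if "d \<in> D" "rel_less r d t" for d
      using not_le[of d s] no that D(3) sF by blast
    then have "(t, s) \<in> r" using t sF unfolding C_def is_supremum_def by blast
    then show False using s L(3) by blast
  qed
  have bw: "\<exists>d \<in> D. rel_less r s d \<and> rel_less r d t" if st: "s \<in> N" "t \<in> N" "rel_less r s t" for s t
  proof (cases "t \<in> C")
    case True
    then show ?thesis using Clow st(3) by blast
  next
    case False
    then have tD: "t \<in> D" using st(2) N_def by blast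
    show ?thesis
    proof (cases "s \<in> D")
      case True
      then show ?thesis using Dbw tD st(3) by blast
    next
      case False
      then have "s \<in> C" using st(1) N_def by blast
      then show ?thesis using tD st(3) unfolding C_def by blast
    qed
  qed
  define q where "q = Restr r N"
  have qiff: "(a, b) \<in> q \<longleftrightarrow> (a, b) \<in> r \<and> a \<in> N \<and> b \<in> N" for a b unfolding q_def by auto
  have Fq: "Field q = N"
  proof
    show "Field q \<subseteq> N" unfolding Field_def q_def by auto
    show "N \<subseteq> Field q"
    proof
      fix a assume "a \<in> N"
      then have "(a, a) \<in> q" using qiff L(1) NF by blast
      then show "a \<in> Field q" by (auto simp: Field_def)
    qed
  qed
  have linq: "Linear_order q" unfolding q_def by (rule Linear_order_Restr[OF lin])
  have mM: "m \<in> N" "M \<in> N" using D N_def by auto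
  have minq: "is_minimum q m" unfolding is_minimum_def Fq using mM mF NF qiff by blast
  have maxq: "is_maximum q M" unfolding is_maximum_def Fq using mM MF NF qiff by blast
  have "m \<noteq> M"
  proof
    assume "m = M"
    then have "a = m" if "a \<in> Field r" for a using mF MF that L(3) by blast
    then show False using dn unfolding dense_rel_def by metis
  qed
  then have dnq: "dense_rel q"
    unfolding dense_rel_def Fq using mM bw qiff N_def by (metis UnI1)
  have ocq: "order_complete_rel q"
    unfolding order_complete_rel_def Fq
  proof (intro allI impI)
    fix S assume S: "S \<subseteq> N" "S \<noteq> {} \<and> (\<exists>b \<in> N. \<forall>s \<in> S. (s, b) \<in> q)"
    define A where "A = {d \<in> D. \<exists>s \<in> S. (d, s) \<in> r}"
    have SF: "S \<subseteq> Field r" using S NF by auto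
    have "m \<in> A" using S(2) SF mF D(1) unfolding A_def by auto
    moreover have AF: "A \<subseteq> Field r" using D(3) unfolding A_def by auto
    ultimately obtain u where u: "is_supremum r A u"
      using oc MF unfolding order_complete_rel_def by (metis empty_iff subsetD)
    have uF: "u \<in> Field r" and uub: "\<And>d. d \<in> A \<Longrightarrow> (d, u) \<in> r"
      and ul: "\<And>v. v \<in> Field r \<Longrightarrow> (\<And>d. d \<in> A \<Longrightarrow> (d, v) \<in> r) \<Longrightarrow> (u, v) \<in> r"
      using u unfolding is_supremum_def by auto
    have ub_le: "(u, v) \<in> r" if v: "v \<in> N" "\<forall>s \<in> S. (s, v) \<in> r" for v
    proof (rule ul)
      show "v \<in> Field r" using v NF by auto
      show "(d, v) \<in> r" if "d \<in> A" for d using that v L(2) unfolding A_def by blast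
    qed
    have inN: "\<exists>u. is_supremum q S u" if uN: "u \<in> N"
    proof -
      have "(s, u) \<in> r" if s: "s \<in> S" for s
      proof (rule ccontr)
        assume "(s, u) \<notin> r"
        then have "rel_less r u s" using not_le s SF uF by blast
        then obtain d where d: "d \<in> D" "rel_less r u d" "rel_less r d s" using bw uN s S(1) by blast
        then have "d \<in> A" using s unfolding A_def by blast
        then show False using uub d L(3) by blast
      qed
      then have "is_supremum q S u"
        unfolding is_supremum_def Fq qiff using uN S(1) ub_le by blast
      then show ?thesis by blast
    qed
    show "\<exists>u. is_supremum q S u"
    proof (cases "u \<in> N")
      case True
      then show ?thesis by (rule inN)
    next
      case False
      then have uD: "u \<notin> D" and uC: "u \<notin> C" unfolding N_def by auto
      have "is_supremum r {d \<in> D. rel_less r d u} u"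
        unfolding is_supremum_def
      proof (intro conjI ballI impI)
        show "u \<in> Field r" by (rule uF)
        show "(s, u) \<in> r" if "s \<in> {d \<in> D. rel_less r d u}" for s using that by blast
        fix v assume v: "v \<in> Field r" "\<forall>s \<in> {d \<in> D. rel_less r d u}. (s, v) \<in> r"
        show "(u, v) \<in> r"
        proof (rule ul[OF v(1)])
          fix d assume d: "d \<in> A"
          then have "d \<in> D" unfolding A_def by blast
          then show "(d, v) \<in> r" using uub[OF d] v(2) uD by blast
        qed
      qed
      then obtain b where b: "b \<in> D" "rel_less r u b"
        and bmin: "\<And>b'. b' \<in> D \<Longrightarrow> rel_less r u b' \<Longrightarrow> \<not> rel_less r b' b"
        using uF uD uC unfolding C_def by blast
      have bN: "b \<in> N" using b N_def by auto
      have bF: "b \<in> Field r" using b D by auto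
      have sb: "(s, b) \<in> r" if s: "s \<in> S" for s
      proof (rule ccontr)
        assume "(s, b) \<notin> r"
        then have "rel_less r b s" using not_le s SF bF by blast
        then have "b \<in> A" using s b(1) unfolding A_def by blast
        then show False using uub b(2) L(3) by blast
      qed
      have "(b, v) \<in> r" if v: "v \<in> N" "\<forall>s \<in> S. (s, v) \<in> r" for v
      proof (rule ccontr)
        assume nb: "(b, v) \<notin> r"
        have vF: "v \<in> Field r" using v NF by auto
        have vb: "rel_less r v b" using not_le[OF bF vF nb] .
        have uv: "(u, v) \<in> r" using ub_le v by blast
        obtain d where d: "d \<in> D" "rel_less r v d" "rel_less r d b" using bw[OF v(1) bN vb] by blast
        then have "rel_less r u d" using le_less uv by blast
        then show False using bmin d by blast
      qed
      then have "is_supremum q S b"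
        unfolding is_supremum_def Fq qiff using bN S(1) sb by blast
      then show ?thesis by blast
    qed
  qed
  have biq: "big_interval q"
    unfolding big_interval_def using linq dnq ocq minq maxq by blast
  have lq: "left_nbhd q (\<lambda>z. \<gamma> z \<in> U) t" if U: "openin X U" and t: "t \<in> N" "\<gamma> t \<in> U" for U t
  proof (cases "t = m")
    case True
    then have "\<not> rel_less q a t" for a using qiff mF NF L(3) by blast
    then show ?thesis unfolding left_nbhd_def by blast
  next
    case False
    have tF: "t \<in> Field r" using t NF by auto
    have "rel_less r m t" using False mF tF by auto
    moreover have "left_nbhd r (\<lambda>z. \<gamma> z \<in> U) t" using c U t tF by blast
    ultimately obtain a where a: "LW U t a" unfolding left_nbhd_def LW_def by blast
    have "\<exists>a \<in> D. LW U t a"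
    proof (cases "t \<in> D")
      case True
      then show ?thesis using PD[of t t U] a unfolding P_def by blast
    next
      case False
      then have "t \<in> C" using t N_def by blast
      then obtain d where d: "d \<in> D" "rel_less r a d" "rel_less r d t"
        using Clow a unfolding LW_def by blast
      then have "LW U t d" using a less_le unfolding LW_def by blast
      then show ?thesis using d by blast
    qed
    then obtain d where d: "d \<in> D" "LW U t d" by blast
    have "d \<in> N" using d N_def by blast
    then show ?thesis using d t unfolding left_nbhd_def LW_def qiff by blast
  qed
  have rq: "right_nbhd q (\<lambda>z. \<gamma> z \<in> U) t" if U: "openin X U" and t: "t \<in> N" "\<gamma> t \<in> U" for U t
  proof (cases "t = M")
    case True
    then have "\<not> rel_less q t a" for a using qiff MF NF L(3) by blast
    then show ?thesis unfolding right_nbhd_def by blast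
  next
    case False
    have tF: "t \<in> Field r" using t NF by auto
    have tM: "rel_less r t M" using False MF tF by auto
    have "right_nbhd r (\<lambda>z. \<gamma> z \<in> U) t" using c U t tF by blast
    then obtain a where a: "RW U t a" using tM unfolding right_nbhd_def RW_def by blast
    have "\<exists>a \<in> D. RW U t a"
    proof (cases "t \<in> D")
      case True
      then show ?thesis using PD[of t t U] a unfolding P_def by blast
    next
      case False
      then have tC: "t \<in> C" using t N_def by blast
      have "rel_less r m t" using False D(1) mF tF by blast
      moreover have "left_nbhd r (\<lambda>z. \<gamma> z \<in> U) t" using c U t tF by blast
      ultimately obtain a where a: "LW U t a" unfolding left_nbhd_def LW_def by blast
      then obtain d where d: "d \<in> D" "rel_less r a d" "rel_less r d t"
        using Clow tC unfolding LW_def by blast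
      have dU: "\<gamma> z \<in> U" if "(d, z) \<in> r" "(z, t) \<in> r" for z
        using a d that less_le[of a d z] unfolding LW_def by blast
      have trun: "t \<in> run U d" using d dU unfolding run_def by blast
      have "run U d \<subseteq> Field r" unfolding run_def using L(5) by blast
      moreover have "\<forall>s \<in> run U d. (s, M) \<in> r" using calculation MF by blast
      ultimately have "\<exists>u. is_supremum r (run U d) u"
        using oc MF(1) trun unfolding order_complete_rel_def by blast
      then obtain w where w: "w \<in> D" "is_supremum r (run U d) w"
        using PD[of d d U] d unfolding P_def by blast
      have tw: "rel_less r t w" using w trun False unfolding is_supremum_def by blast
      have "\<gamma> z \<in> U" if z: "rel_less r z w" "(t, z) \<in> r" for z
      proof -
        have zF: "z \<in> Field r" using z L(5) by blast
        have "\<exists>v \<in> run U d. (v, z) \<notin> r"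
        proof (rule ccontr)
          assume "\<not> ?thesis"
          then have "(w, z) \<in> r" using w(2) zF unfolding is_supremum_def by blast
          then show False using z L(3) by blast
        qed
        then obtain v where v: "v \<in> run U d" "(v, z) \<notin> r" by blast
        then have "v \<in> Field r" using L(5) unfolding run_def by blast
        then have "rel_less r z v" using not_le zF v by blast
        moreover have "(d, z) \<in> r" using d z L(2) by blast
        ultimately show ?thesis using v(1) unfolding run_def by blast
      qed
      then have "RW U t w" using tw unfolding RW_def by blast
      then show ?thesis using w by blast
    qed
    then obtain d where d: "d \<in> D" "RW U t d" by blast
    have "d \<in> N" using d N_def by blast
    then show ?thesis using d t unfolding right_nbhd_def RW_def qiff by blast
  qed
  have "continuous_map (order_topology_of q) X \<gamma>"
    unfolding continuous_map_order_topology_of[OF linq] Fq using lq rq c NF by blast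
  then have "big_path X q \<gamma> x y"
    using bp biq min_of_eq[OF lin m] min_of_eq[OF linq minq] max_of_eq[OF lin M] max_of_eq[OF linq maxq]
    unfolding big_path_def by simp
  moreover
  obtain g :: "'l \<Rightarrow> 'a set list" where g: "inj_on g D"
    using D(4) unfolding card_of_ordLeq[symmetric] by blast
  define cut where "cut s = {d \<in> D. (d, s) \<in> r}" for s
  have cutne: "cut s \<noteq> cut t" if st: "s \<in> N" "t \<in> N" "rel_less r s t" for s t
  proof -
    obtain d where "d \<in> D" "rel_less r s d" "rel_less r d t" using bw[OF st] by blast
    then have "d \<in> cut t" "d \<notin> cut s" using L(3) unfolding cut_def by blast+
    then show ?thesis by blast
  qed
  have "inj_on (\<lambda>s. g ` cut s) N"
  proof (rule inj_onI, rule ccontr)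
    fix s t assume st: "s \<in> N" "t \<in> N" "g ` cut s = g ` cut t" "s \<noteq> t"
    have "cut s \<subseteq> D" "cut t \<subseteq> D" unfolding cut_def by auto
    then have eq: "cut s = cut t" using g st(3) by (simp add: inj_on_image_eq_iff)
    have "rel_less r s t \<or> rel_less r t s" using st NF L(4)[of s t] by auto
    then show False using cutne st eq by metis
  qed
  ultimately show thesis using that Fq by metis
qed

theorem big_path_joined_if_big_path:
  fixes X :: "'a topology" and r :: "'l rel"
  assumes "big_path X r \<gamma> x y"
  shows "big_path_joined X x y"
  using big_path_small_restriction[OF assms] big_path_transfer unfolding big_path_joined_def by metis

end

theory Submission
  imports Defs
begin

text \<open>
  Removing two points \<open>a\<close>, \<open>b\<close> of a \<open>2\<close>-big-path-flimsy space \<open>X\<close> disconnects it; call two points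
  separated by \<open>{a, b}\<close> if no big path in \<open>X - {a, b}\<close> joins them. The whole proof is a calculus of
  this relation between two pairs of points. Its basis is that a big path in \<open>X - {b}\<close> from \<open>x\<close> to
  \<open>a\<close> can be stopped when it first meets \<open>a\<close>, so that \<open>a\<close> is reached without leaving the component
  of \<open>x\<close> in \<open>X - {a, b}\<close> before (\<open>joined_within_puncture\<close>). Since \<open>X - {b}\<close> and \<open>X - {a}\<close> are
  connected, each component of \<open>X - {a, b}\<close> is thus attached to both \<open>a\<close> and \<open>b\<close>. It follows that
  separation is symmetric (\<open>separates_swap\<close>): if \<open>{a, b}\<close> separates \<open>c\<close> from \<open>d\<close>, then \<open>{c, d}\<close>
  separates \<open>a\<close> from \<open>b\<close>. It also follows that \<open>X - {a, b}\<close> has exactly two components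
  (\<open>not_three_separated\<close>).

  Symmetry has several consequences. First, \<open>X\<close> is \<open>T\<^sub>1\<close>: if every neighbourhood of \<open>y\<close> contained \<open>x\<close>,
  then \<open>x\<close> and \<open>y\<close> would be joined by a two-valued path in \<open>X - {c, d}\<close> for all other points \<open>c\<close>,
  \<open>d\<close>, whereas some pair \<open>{c, d}\<close> is separated by \<open>{x, y}\<close>. Hence preimages of
  components of \<open>X - {a, b}\<close> under a big path are open, and big paths of \<open>X\<close> are big paths of the component topology. Secondly, the component
  topology is finer than that of \<open>X\<close> (\<open>finer_component_topology\<close>): inside an open \<open>U\<close> a point \<open>x\<close> is
  joined to points \<open>w\<close>, \<open>w'\<close> on its two sides, and the component of \<open>x\<close> in \<open>X - {w, w'}\<close> consists of
  points that these two paths have to cross. The two topologies therefore have the same big paths and the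
  same big-path-connected subsets, and the component topology is again flimsy. Thirdly, the component
  topology is Hausdorff: two points \<open>x\<close>, \<open>y\<close> lie in distinct components of \<open>X - {a, b}\<close> whenever
  \<open>{x, y}\<close> separates \<open>a\<close> from \<open>b\<close>. Finally, \<open>X\<close> is compact, being the union of the images of two
  big paths from \<open>a\<close> to \<open>b\<close>, one avoiding \<open>c\<close> and one avoiding \<open>d\<close>, where \<open>{a, b}\<close> separates \<open>c\<close>
  from \<open>d\<close>.

  For uniqueness, a flimsy topology \<open>Y\<close> finer than that of \<open>X\<close> has no more big paths; but since
  complements of pairs have exactly two components in both, these components are the same, and so is the
  component topology. The latter is compact and finer than \<open>Y\<close>, so it equals \<open>Y\<close> if \<open>Y\<close> is Hausdorff.
\<close>

section \<open>Big paths within a subset\<close>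

lemma big_path_subtopology_iff:
  "big_path (subtopology X A) r \<gamma> x y \<longleftrightarrow> big_path X r \<gamma> x y \<and> \<gamma> ` Field r \<subseteq> A"
  unfolding big_path_def continuous_map_in_subtopology topspace_order_topology_of by auto

text \<open>
  The points \<open>x\<close> and \<open>y\<close> are joined by a big path whose values lie in \<open>A\<close>. Values in \<open>A\<close> but outside
  the space are impossible, so \<open>A\<close> need not be a subset of the space.
\<close>
definition joined_within :: "'a topology \<Rightarrow> 'a set \<Rightarrow> 'a \<Rightarrow> 'a \<Rightarrow> bool" where
  "joined_within X A x y \<longleftrightarrow> big_path_joined (subtopology X A) x y"

text \<open>The big interval of a witnessing path may live on any type.\<close>
lemma joined_withinI:
  "big_path X r \<gamma> x y \<Longrightarrow> \<gamma> ` Field r \<subseteq> A \<Longrightarrow> joined_within X A x y"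
  unfolding joined_within_def
  by (meson big_path_joined_if_big_path big_path_subtopology_iff)

lemma joined_withinE:
  fixes X :: "'a topology"
  assumes "joined_within X A x y"
  obtains r :: "'a set list set rel" and \<gamma> where "big_path X r \<gamma> x y" "\<gamma> ` Field r \<subseteq> A"
  using assms unfolding joined_within_def big_path_joined_def
  by (auto simp: big_path_subtopology_iff)

lemma joined_within_mono: "joined_within X A x y \<Longrightarrow> A \<subseteq> B \<Longrightarrow> joined_within X B x y"
  by (erule joined_withinE) (blast intro: joined_withinI)

lemma big_intervalE:
  assumes "big_interval r"
  obtains "Linear_order r" "dense_rel r" "order_complete_rel r"
    "min_of r \<in> Field r" "\<And>t. t \<in> Field r \<Longrightarrow> (min_of r, t) \<in> r"
    "max_of r \<in> Field r" "\<And>t. t \<in> Field r \<Longrightarrow> (t, max_of r) \<in> r"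
    "min_of r \<noteq> max_of r"
proof -
  have lin: "Linear_order r" and dn: "dense_rel r" using assms unfolding big_interval_def by auto
  obtain m M where m: "is_minimum r m" and M: "is_maximum r M"
    using assms unfolding big_interval_def by auto
  have "m \<noteq> M"
    using dn m M linear_rel_facts(3)[OF lin]
    unfolding dense_rel_def is_minimum_def is_maximum_def by metis
  moreover have "min_of r = m" "max_of r = M" using min_of_eq[OF lin m] max_of_eq[OF lin M] by auto
  ultimately show thesis
    using that assms m M unfolding big_interval_def is_minimum_def is_maximum_def by auto
qed

lemma big_path_endpoints:
  assumes "big_path X r \<gamma> x y"
  shows "x \<in> \<gamma> ` Field r" "y \<in> \<gamma> ` Field r" "\<gamma> ` Field r \<subseteq> topspace X"
proof -
  have bi: "big_interval r" using assms by (simp add: big_path_def)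
  show "x \<in> \<gamma> ` Field r" "y \<in> \<gamma> ` Field r"
    using assms by (auto simp: big_path_def intro: big_intervalE[OF bi])
  show "\<gamma> ` Field r \<subseteq> topspace X"
    using assms unfolding big_path_def continuous_map_def topspace_order_topology_of by auto
qed

lemma joined_within_in:
  assumes "joined_within X A x y"
  shows "x \<in> A" "y \<in> A" "x \<in> topspace X" "y \<in> topspace X"
  using assms by (auto elim!: joined_withinE dest: big_path_endpoints)

text \<open>
  A path may be frozen at the value \<open>a\<close> on an upper set \<open>Z\<close> of its interval, provided that below each
  point of \<open>Z\<close> there is a point of \<open>Z\<close> where the path takes the value \<open>a\<close>. If \<open>Z\<close> has a least element,
  then the path has the value \<open>a\<close> there. If instead the complement of \<open>Z\<close> has a greatest element \<open>t\<close>,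
  then \<open>a\<close> lies in every open set containing the value at \<open>t\<close>, which is all that continuity at \<open>t\<close>
  requires. Hence singletons need not be closed.
\<close>
lemma big_path_stop:
  assumes bp: "big_path X r \<gamma> x y"
    and Z: "max_of r \<in> Z" "Z \<subseteq> Field r" "\<And>s t. s \<in> Z \<Longrightarrow> (s, t) \<in> r \<Longrightarrow> t \<in> Z"
    and hit: "\<And>t. t \<in> Z \<Longrightarrow> \<exists>s \<in> Z. (s, t) \<in> r \<and> \<gamma> s = a"
  shows "big_path X r (\<lambda>t. if t \<in> Z then a else \<gamma> t) x a"
proof -
  let ?d = "\<lambda>t. if t \<in> Z then a else \<gamma> t"
  have bi: "big_interval r" and co: "continuous_map (order_topology_of r) X \<gamma>"
    and ends: "\<gamma> (min_of r) = x" using bp by (auto simp: big_path_def)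
  have lin: "Linear_order r" by (rule big_intervalE[OF bi])
  note L = linear_rel_facts[OF lin]
  note c = co[unfolded continuous_map_order_topology_of[OF lin]]
  have "?d (min_of r) = x"
  proof -
    have "(min_of r, s) \<in> r" if "s \<in> Z" for s using that Z(2) big_intervalE[OF bi] by blast
    then show ?thesis using hit[of "min_of r"] L(3) ends by auto
  qed
  moreover have "continuous_map (order_topology_of r) X ?d"
    unfolding continuous_map_order_topology_of[OF lin]
  proof (intro conjI ballI allI impI)
    fix t assume "t \<in> Field r"
    then show "?d t \<in> topspace X" using c hit[of t] Z(2) by auto
  next
    fix U t assume U: "openin X U" and t: "t \<in> Field r" "?d t \<in> U"
    show "left_nbhd r (\<lambda>z. ?d z \<in> U) t"
    proof (cases "\<exists>s \<in> Z. rel_less r s t")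
      case True
      then obtain s where s: "s \<in> Z" "rel_less r s t" by blast
      then have "?d z \<in> U" if "rel_less r s z" for z using that Z(3) t by auto
      then show ?thesis using s unfolding left_nbhd_def by blast
    next
      case False
      then have "t \<in> Z \<Longrightarrow> \<gamma> t = a" using hit by blast
      then have "\<gamma> t \<in> U" using t by (auto split: if_splits)
      then have "left_nbhd r (\<lambda>z. \<gamma> z \<in> U) t" using c U t by blast
      moreover have "?d z = \<gamma> z \<or> z = t" if "(z, t) \<in> r" for z using that False by auto
      ultimately show ?thesis using t unfolding left_nbhd_def by metis
    qed
    show "right_nbhd r (\<lambda>z. ?d z \<in> U) t"
    proof (cases "t \<in> Z")
      case True
      then have "?d z \<in> U" if "(t, z) \<in> r" for z using that Z(3) t by auto
      then show ?thesis unfolding right_nbhd_def by blast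
    next
      case False
      then have "right_nbhd r (\<lambda>z. \<gamma> z \<in> U) t" using c U t by auto
      moreover have "?d z \<in> U"
        if b: "rel_less r z b" "(t, z) \<in> r" "\<forall>z. rel_less r z b \<longrightarrow> (t, z) \<in> r \<longrightarrow> \<gamma> z \<in> U" for z b
      proof (cases "z \<in> Z")
        case True
        then obtain s where s: "s \<in> Z" "(s, z) \<in> r" "\<gamma> s = a" using hit by blast
        then have "(t, s) \<in> r" using False Z(2,3) L(4)[of s t] t by blast
        moreover have "rel_less r s b" using s b L(2,3) by blast
        ultimately show ?thesis using b s True by auto
      qed (use b in auto)
      ultimately show ?thesis unfolding right_nbhd_def by blast
    qed
  qed
  ultimately show ?thesis using Z(1) bi unfolding big_path_def by simp
qed

lemma big_interval_converse:
  assumes bi: "big_interval r"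
  shows "big_interval (r\<inverse>)" "min_of (r\<inverse>) = max_of r" "max_of (r\<inverse>) = min_of r"
proof -
  have lin: "Linear_order r" and dn: "dense_rel r" and oc: "order_complete_rel r"
    and m: "min_of r \<in> Field r" "\<And>t. t \<in> Field r \<Longrightarrow> (min_of r, t) \<in> r"
    and M: "max_of r \<in> Field r" "\<And>t. t \<in> Field r \<Longrightarrow> (t, max_of r) \<in> r"
    by (rule big_intervalE[OF bi]; blast)+
  note L = linear_rel_facts[OF lin]
  have lin': "Linear_order (r\<inverse>)" using lin by simp
  have mm: "is_minimum (r\<inverse>) (max_of r)" "is_maximum (r\<inverse>) (min_of r)"
    using m M unfolding is_minimum_def is_maximum_def by auto
  then show "min_of (r\<inverse>) = max_of r" "max_of (r\<inverse>) = min_of r"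
    using min_of_eq[OF lin' mm(1)] max_of_eq[OF lin' mm(2)] by auto
  have "dense_rel (r\<inverse>)" using dn unfolding dense_rel_def by (simp, metis)
  moreover have "order_complete_rel (r\<inverse>)"
    unfolding order_complete_rel_def
  proof (intro allI impI)
    fix S assume S: "S \<subseteq> Field (r\<inverse>)" "S \<noteq> {} \<and> (\<exists>b \<in> Field (r\<inverse>). \<forall>s \<in> S. (s, b) \<in> r\<inverse>)"
    \<comment> \<open>The infimum of \<open>S\<close> is the supremum of its lower bounds.\<close>
    let ?B = "{b \<in> Field r. \<forall>s \<in> S. (b, s) \<in> r}"
    have "?B \<noteq> {} \<and> (\<exists>b \<in> Field r. \<forall>s \<in> ?B. (s, b) \<in> r)" using S by auto
    moreover have "?B \<subseteq> Field r" by auto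
    ultimately obtain u where "is_supremum r ?B u"
      using oc unfolding order_complete_rel_def by meson
    then have "is_supremum (r\<inverse>) S u" using S(1) unfolding is_supremum_def by auto
    then show "\<exists>u. is_supremum (r\<inverse>) S u" by blast
  qed
  ultimately show "big_interval (r\<inverse>)" using lin' mm unfolding big_interval_def by blast
qed

lemma big_path_reverse:
  assumes bp: "big_path X r \<gamma> x y"
  shows "big_path X (r\<inverse>) \<gamma> y x"
proof -
  have bi: "big_interval r" using bp by (simp add: big_path_def)
  have lin: "Linear_order r" by (rule big_intervalE[OF bi])
  have "order_topology_of (r\<inverse>) = order_topology_of r"
  proof -
    have "underS (r\<inverse>) = aboveS r" "aboveS (r\<inverse>) = underS r"
      by (auto simp: underS_def aboveS_def fun_eq_iff)
    then show ?thesis unfolding order_topology_of_def by (simp add: Un_assoc Un_left_commute Un_commute)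
  qed
  then show ?thesis using bp big_interval_converse[OF bi] unfolding big_path_def by auto
qed

lemma joined_within_sym: "joined_within X A x y \<Longrightarrow> joined_within X A y x"
  by (metis Field_converse big_path_reverse joined_withinE joined_withinI)

text \<open>
  A segment of a big path is obtained by stopping the path at \<open>t\<close>, reversing it, and stopping it again
  at \<open>s\<close>; so no subinterval has to be shown to be a big interval.
\<close>
lemma joined_within_segment:
  assumes bp: "big_path X r \<gamma> x y" and st: "(s, t) \<in> r"
  shows "joined_within X (\<gamma> ` {z. (s, z) \<in> r \<and> (z, t) \<in> r}) (\<gamma> s) (\<gamma> t)"
proof -
  have bi: "big_interval r" using bp by (simp add: big_path_def)
  have lin: "Linear_order r" by (rule big_intervalE[OF bi])
  note L = linear_rel_facts[OF lin]
  have m: "min_of r \<in> Field r" "\<And>t. t \<in> Field r \<Longrightarrow> (min_of r, t) \<in> r"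
    and M: "max_of r \<in> Field r" "\<And>t. t \<in> Field r \<Longrightarrow> (t, max_of r) \<in> r"
    by (rule big_intervalE[OF bi]; blast)+
  have F: "s \<in> Field r" "t \<in> Field r" using st L by blast+
  let ?d = "\<lambda>z. if z \<in> {z. (t, z) \<in> r} then \<gamma> t else \<gamma> z"
  have "big_path X r ?d x (\<gamma> t)"
  proof (rule big_path_stop[OF bp])
    show "\<exists>s \<in> {z. (t, z) \<in> r}. (s, u) \<in> r \<and> \<gamma> s = \<gamma> t" if "u \<in> {z. (t, z) \<in> r}" for u
      using that F L(1) by blast
    show "{z. (t, z) \<in> r} \<subseteq> Field r" using L(5) by blast
    show "v \<in> {z. (t, z) \<in> r}" if "u \<in> {z. (t, z) \<in> r}" "(u, v) \<in> r" for u v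
      using that L(2) by blast
  qed (use F M in blast)
  from big_path_reverse[OF this]
  have bp': "big_path X (r\<inverse>) ?d (\<gamma> t) x" .
  let ?e = "\<lambda>z. if z \<in> {z. (z, s) \<in> r} then ?d s else ?d z"
  have bpe: "big_path X (r\<inverse>) ?e (\<gamma> t) (?d s)"
  proof (rule big_path_stop[OF bp'])
    show "max_of (r\<inverse>) \<in> {z. (z, s) \<in> r}" using F m big_interval_converse[OF bi] by auto
    show "\<exists>s' \<in> {z. (z, s) \<in> r}. (s', u) \<in> r\<inverse> \<and> ?d s' = ?d s" if "u \<in> {z. (z, s) \<in> r}" for u
      using that F L(1)[of s] by (intro bexI[of _ s]) auto
    show "{z. (z, s) \<in> r} \<subseteq> Field (r\<inverse>)" using L(5) by auto
    show "v \<in> {z. (z, s) \<in> r}" if "u \<in> {z. (z, s) \<in> r}" "(u, v) \<in> r\<inverse>" for u v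
      using that L(2)[of v u s] by blast
  qed
  have ds: "?d s = \<gamma> s" using st L(3)[of s t] by auto
  have "?e ` Field (r\<inverse>) \<subseteq> \<gamma> ` {z. (s, z) \<in> r \<and> (z, t) \<in> r}"
  proof
    fix y assume "y \<in> ?e ` Field (r\<inverse>)"
    then obtain z where z: "y = ?e z" "z \<in> Field r" unfolding Field_converse by (rule imageE)
    show "y \<in> \<gamma> ` {z. (s, z) \<in> r \<and> (z, t) \<in> r}"
    proof (cases "(z, s) \<in> r \<or> (t, z) \<in> r")
      case True
      then have "y = \<gamma> s \<or> y = \<gamma> t" using z(1) ds by auto
      then show ?thesis using st F L(1) by blast
    next
      case False
      then have "y = \<gamma> z" "(s, z) \<in> r" "(z, t) \<in> r" using z F L(4) by auto
      then show ?thesis by blast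
    qed
  qed
  from joined_withinI[OF bpe this] show ?thesis unfolding ds by (rule joined_within_sym)
qed

lemma ex_big_interval: "\<exists>r :: real rel. big_interval r"
proof -
  let ?r = "{(a, b). 0 \<le> a \<and> a \<le> b \<and> b \<le> (1::real)}"
  have F: "Field ?r = {0..1}" by (auto simp: Field_def)
  have "Linear_order ?r"
    unfolding order_on_defs F refl_on_def trans_def antisym_def total_on_def by auto
  moreover have "dense_rel ?r"
    unfolding dense_rel_def F
  proof (intro conjI allI impI)
    show "\<exists>a \<in> {0..1}. \<exists>b \<in> {0..1}. a \<noteq> (b::real)" by (rule bexI[of _ 0], rule bexI[of _ 1]) auto
    show "\<exists>c. rel_less ?r a c \<and> rel_less ?r c b" if "rel_less ?r a b" for a b
      using that by (intro exI[of _ "(a + b) / 2"]) auto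
  qed
  moreover have "order_complete_rel ?r"
    unfolding order_complete_rel_def F
  proof (intro allI impI)
    fix S :: "real set" assume S: "S \<subseteq> {0..1}" "S \<noteq> {} \<and> (\<exists>b \<in> {0..1}. \<forall>s \<in> S. (s, b) \<in> ?r)"
    have bdd: "bdd_above S" using S by (intro bdd_aboveI[of _ 1]) auto
    obtain s where s: "s \<in> S" using S by auto
    have "0 \<le> Sup S" using s S bdd by (meson atLeastAtMost_iff cSup_upper order_trans subsetD)
    moreover have "Sup S \<le> 1" using S by (intro cSup_least) auto
    ultimately have "is_supremum ?r S (Sup S)"
      unfolding is_supremum_def F using S bdd by (auto intro: cSup_upper cSup_least)
    then show "\<exists>u. is_supremum ?r S u" by blast
  qed
  moreover have "is_minimum ?r 0" "is_maximum ?r 1" unfolding is_minimum_def is_maximum_def F by auto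
  ultimately show ?thesis unfolding big_interval_def by blast
qed

text \<open>
  If every open set containing \<open>x\<close> contains \<open>y\<close>, then the function which is \<open>x\<close> at the minimum of a
  big interval and \<open>y\<close> elsewhere is continuous.
\<close>
lemma joined_within_specialization:
  assumes "x \<in> A" "y \<in> A" "x \<in> topspace X" "y \<in> topspace X"
    and sp: "\<And>U. openin X U \<Longrightarrow> x \<in> U \<Longrightarrow> y \<in> U"
  shows "joined_within X A x y"
proof -
  obtain r :: "real rel" where bi: "big_interval r" using ex_big_interval by blast
  have lin: "Linear_order r" and ne: "min_of r \<noteq> max_of r"
    and m: "min_of r \<in> Field r" "\<And>t. t \<in> Field r \<Longrightarrow> (min_of r, t) \<in> r"
    by (rule big_intervalE[OF bi]; blast)+
  note L = linear_rel_facts[OF lin]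
  let ?g = "\<lambda>t. if t = min_of r then x else y"
  have "left_nbhd r (\<lambda>z. ?g z \<in> U) t" "right_nbhd r (\<lambda>z. ?g z \<in> U) t"
    if U: "openin X U" "t \<in> Field r" "?g t \<in> U" for U t
  proof -
    have yU: "y \<in> U" using U sp by (auto split: if_splits)
    show "right_nbhd r (\<lambda>z. ?g z \<in> U) t"
    proof -
      have "?g z \<in> U" if "(t, z) \<in> r" for z
      proof (cases "z = min_of r")
        case True
        then have "z = t" using that m(2)[of t] L(3) U(2) by blast
        then show ?thesis using U(3) by blast
      qed (use yU in simp)
      then show ?thesis unfolding right_nbhd_def by blast
    qed
    have "?g z \<in> U" if "rel_less r a z" for a z
    proof -
      have "a \<in> Field r" using that L(5) by blast
      then have "z \<noteq> min_of r" using that m(2)[of a] L(3)[of a z] by blast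
      then show ?thesis using yU by simp
    qed
    then show "left_nbhd r (\<lambda>z. ?g z \<in> U) t" unfolding left_nbhd_def by blast
  qed
  then have "continuous_map (order_topology_of r) X ?g"
    unfolding continuous_map_order_topology_of[OF lin] using assms by auto
  then have "big_path X r ?g x y" unfolding big_path_def using bi ne by simp
  then show ?thesis by (rule joined_withinI) (use assms in auto)
qed

lemma joined_within_refl: "x \<in> A \<Longrightarrow> x \<in> topspace X \<Longrightarrow> joined_within X A x x"
  by (rule joined_within_specialization)

section \<open>Concatenation of big paths\<close>

text \<open>
  The concatenation is indexed by the sum of the two intervals, in which the minimum of the second one is
  omitted, its role being played by the maximum of the first one.
\<close>
lemma joined_within_append:
  fixes X :: "'a topology" and r1 :: "'l rel" and r2 :: "'m rel"
  assumes p1: "big_path X r1 g1 x y" "g1 ` Field r1 \<subseteq> A"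
    and p2: "big_path X r2 g2 y z" "g2 ` Field r2 \<subseteq> A"
  shows "joined_within X A x z"
proof -
  have bi1: "big_interval r1" and co1: "continuous_map (order_topology_of r1) X g1"
    and e1: "g1 (min_of r1) = x" "g1 (max_of r1) = y" using p1 by (auto simp: big_path_def)
  have bi2: "big_interval r2" and co2: "continuous_map (order_topology_of r2) X g2"
    and e2: "g2 (min_of r2) = y" "g2 (max_of r2) = z" using p2 by (auto simp: big_path_def)
  have lin1: "Linear_order r1" and dn1: "dense_rel r1" and oc1: "order_complete_rel r1"
    and m1: "min_of r1 \<in> Field r1" "\<And>t. t \<in> Field r1 \<Longrightarrow> (min_of r1, t) \<in> r1"
    and M1: "max_of r1 \<in> Field r1" "\<And>t. t \<in> Field r1 \<Longrightarrow> (t, max_of r1) \<in> r1"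
    by (rule big_intervalE[OF bi1]; blast)+
  have lin2: "Linear_order r2" and dn2: "dense_rel r2" and oc2: "order_complete_rel r2"
    and m2: "min_of r2 \<in> Field r2" "\<And>t. t \<in> Field r2 \<Longrightarrow> (min_of r2, t) \<in> r2"
    and M2: "max_of r2 \<in> Field r2" "\<And>t. t \<in> Field r2 \<Longrightarrow> (t, max_of r2) \<in> r2"
    and ne2: "min_of r2 \<noteq> max_of r2"
    by (rule big_intervalE[OF bi2]; blast)+
  note L1 = linear_rel_facts[OF lin1] and L2 = linear_rel_facts[OF lin2]
  note c1 = co1[unfolded continuous_map_order_topology_of[OF lin1]]
  note c2 = co2[unfolded continuous_map_order_topology_of[OF lin2]]
  let ?m = "min_of r2" and ?M = "max_of r1"
  define q where "q = {(u, v). case u of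
      Inl a \<Rightarrow> (case v of Inl b \<Rightarrow> (a, b) \<in> r1 | Inr b \<Rightarrow> a \<in> Field r1 \<and> b \<in> Field r2 \<and> b \<noteq> ?m)
    | Inr a \<Rightarrow> (case v of Inl b \<Rightarrow> False | Inr b \<Rightarrow> (a, b) \<in> r2 \<and> a \<noteq> ?m \<and> b \<noteq> ?m)}"
  have q [simp]: "(Inl a, Inl b) \<in> q \<longleftrightarrow> (a, b) \<in> r1"
    "(Inl a, Inr b') \<in> q \<longleftrightarrow> a \<in> Field r1 \<and> b' \<in> Field r2 \<and> b' \<noteq> ?m"
    "(Inr a', Inl b) \<notin> q"
    "(Inr a', Inr b') \<in> q \<longleftrightarrow> (a', b') \<in> r2 \<and> a' \<noteq> ?m \<and> b' \<noteq> ?m" for a b a' b'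
    by (auto simp: q_def)
  have min2: "a \<noteq> ?m" if "(b, a) \<in> r2" "b \<noteq> ?m" for a b
    using that m2 L2(3,5) by blast
  have F: "Field q = Inl ` Field r1 \<union> Inr ` (Field r2 - {?m})" (is "_ = ?F")
  proof
    have "u \<in> ?F \<and> v \<in> ?F" if "(u, v) \<in> q" for u v
      using that L1(5) L2(5) by (cases u; cases v) auto
    then show "Field q \<subseteq> ?F" unfolding Field_def by blast
    have "(u, u) \<in> q" if "u \<in> ?F" for u
      using that L1(1) L2(1) by (cases u) auto
    then show "?F \<subseteq> Field q" unfolding Field_def by blast
  qed
  have lin: "Linear_order q"
    unfolding order_on_defs
  proof (intro conjI)
    show "q \<subseteq> Field q \<times> Field q" by (auto simp: Field_def)
    show "refl_on (Field q) q" unfolding refl_on_def F using L1(1) L2(1) by auto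
    show "trans q"
    proof (rule transI)
      fix u v w assume "(u, v) \<in> q" "(v, w) \<in> q"
      then show "(u, w) \<in> q"
        by (cases u; cases v; cases w) (simp_all, (metis L1(2,5) L2(2,5))+)
    qed
    show "antisym q"
    proof (rule antisymI)
      fix u v assume "(u, v) \<in> q" "(v, u) \<in> q"
      then show "u = v" by (cases u; cases v) (auto dest: L1(3) L2(3))
    qed
    have "(u, v) \<in> q \<or> (v, u) \<in> q" if "u \<in> ?F" "v \<in> ?F" for u v
      using that L1(4) L2(4) by (cases u; cases v) (simp_all add: image_iff)
    then show "total_on (Field q) q" unfolding total_on_def F by blast
  qed
  note L = linear_rel_facts[OF lin]
  have mn: "is_minimum q (Inl (min_of r1))" unfolding is_minimum_def F using m1 by auto
  have mx: "is_maximum q (Inr (max_of r2))" unfolding is_maximum_def F using M2 ne2 by auto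
  have dn: "dense_rel q"
    unfolding dense_rel_def
  proof (intro conjI allI impI)
    show "\<exists>a \<in> Field q. \<exists>b \<in> Field q. a \<noteq> b"
      using mn mx unfolding is_minimum_def is_maximum_def by (metis Inl_Inr_False)
    fix u v assume uv: "rel_less q u v"
    show "\<exists>w. rel_less q u w \<and> rel_less q w v"
    proof (cases u)
      case u: (Inl a)
      show ?thesis
      proof (cases v)
        case v: (Inl b)
        then have "rel_less r1 a b" using uv u by auto
        then obtain c where "rel_less r1 a c" "rel_less r1 c b"
          using dn1 unfolding dense_rel_def by blast
        then show ?thesis using u v by (intro exI[of _ "Inl c"]) auto
      next
        case v: (Inr b)
        then have "rel_less r2 ?m b" using uv u m2 by auto
        then obtain c where "rel_less r2 ?m c" "rel_less r2 c b"
          using dn2 unfolding dense_rel_def by blast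
        then show ?thesis using u v uv L2(5) by (intro exI[of _ "Inr c"]) auto
      qed
    next
      case u: (Inr a)
      then obtain b where v: "v = Inr b" using uv by (cases v) auto
      then have "rel_less r2 a b" using uv u by auto
      then obtain c where c: "rel_less r2 a c" "rel_less r2 c b"
        using dn2 unfolding dense_rel_def by blast
      then have "c \<noteq> ?m" using u uv v min2 by auto
      then show ?thesis using u v uv c by (intro exI[of _ "Inr c"]) auto
    qed
  qed
  have oc: "order_complete_rel q"
    unfolding order_complete_rel_def
  proof (intro allI impI)
    fix S assume S: "S \<subseteq> Field q" "S \<noteq> {} \<and> (\<exists>b \<in> Field q. \<forall>s \<in> S. (s, b) \<in> q)"
    show "\<exists>u. is_supremum q S u"
    proof (cases "\<exists>b. Inr b \<in> S")
      case True
      then obtain b where b: "Inr b \<in> S" by blast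
      let ?T = "{b. Inr b \<in> S}"
      have T: "?T \<subseteq> Field r2" using S F by auto
      then have "\<forall>s \<in> ?T. (s, max_of r2) \<in> r2" using M2 by auto
      then obtain u where u: "is_supremum r2 ?T u"
        using oc2 T b M2(1) unfolding order_complete_rel_def by (metis (no_types, lifting) empty_iff mem_Collect_eq)
      have bm: "b \<noteq> ?m" using b S F by auto
      have bu: "(b, u) \<in> r2" using u b unfolding is_supremum_def by auto
      then have um: "u \<noteq> ?m" using bm min2 by blast
      have "is_supremum q S (Inr u)"
        unfolding is_supremum_def
      proof (intro conjI ballI impI)
        show "Inr u \<in> Field q" using F um u unfolding is_supremum_def by auto
        show "(s, Inr u) \<in> q" if "s \<in> S" for s
          using that S u um F unfolding is_supremum_def by (cases s) auto
        show "(Inr u, v) \<in> q" if v: "v \<in> Field q" "\<forall>s \<in> S. (s, v) \<in> q" for v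
        proof -
          obtain w where w: "v = Inr w" using v b by (cases v) auto
          then have "w \<in> Field r2" "w \<noteq> ?m" using v F by auto
          moreover have "\<forall>s \<in> ?T. (s, w) \<in> r2" using v(2) w by auto
          ultimately show ?thesis using u um w unfolding is_supremum_def by auto
        qed
      qed
      then show ?thesis by blast
    next
      case False
      let ?T = "{b. Inl b \<in> S}"
      have S': "S = Inl ` ?T"
      proof -
        have "s \<in> Inl ` ?T" if "s \<in> S" for s using that False by (cases s) auto
        then show ?thesis by blast
      qed
      then have T: "?T \<subseteq> Field r1" "?T \<noteq> {}" using S F by auto
      then have "\<forall>s \<in> ?T. (s, max_of r1) \<in> r1" using M1 by auto
      then obtain u where u: "is_supremum r1 ?T u"
        using oc1 T M1(1) unfolding order_complete_rel_def by meson
      have "is_supremum q S (Inl u)"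
        unfolding is_supremum_def
      proof (intro conjI ballI impI)
        show uF: "Inl u \<in> Field q" using F u unfolding is_supremum_def by auto
        show "(s, Inl u) \<in> q" if "s \<in> S" for s
          using that False u unfolding is_supremum_def by (cases s) auto
        show "(Inl u, v) \<in> q" if v: "v \<in> Field q" "\<forall>s \<in> S. (s, v) \<in> q" for v
        proof (cases v)
          case (Inl w)
          then have "w \<in> Field r1" using v F by auto
          moreover have "\<forall>s \<in> ?T. (s, w) \<in> r1" using v(2) Inl by auto
          ultimately show ?thesis using u Inl unfolding is_supremum_def by auto
        next
          case (Inr w)
          then show ?thesis using v(1) F uF by auto
        qed
      qed
      then show ?thesis by blast
    qed
  qed
  let ?d = "case_sum g1 g2"
  have "continuous_map (order_topology_of q) X ?d"
    unfolding continuous_map_order_topology_of[OF lin]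
  proof (intro conjI ballI allI impI)
    show "?d t \<in> topspace X" if "t \<in> Field q" for t using that c1 c2 F by auto
    fix U t assume U: "openin X U" and t: "t \<in> Field q" "?d t \<in> U"
    show "left_nbhd q (\<lambda>z. ?d z \<in> U) t"
    proof (cases t)
      case t': (Inl t')
      have "left_nbhd r1 (\<lambda>z. g1 z \<in> U) t'" using c1 U t t' F by auto
      then consider "\<forall>a. \<not> rel_less r1 a t'"
        | a where "rel_less r1 a t'" "\<forall>z. rel_less r1 a z \<longrightarrow> (z, t') \<in> r1 \<longrightarrow> g1 z \<in> U"
        unfolding left_nbhd_def by blast
      then show ?thesis
      proof cases
        case 1
        have "\<not> rel_less q u t" for u using 1 t' by (cases u) auto
        then show ?thesis unfolding left_nbhd_def by blast
      next
        case 2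
        have "?d u \<in> U" if "rel_less q (Inl a) u" "(u, t) \<in> q" for u
          using that 2 t' by (cases u) auto
        moreover have "rel_less q (Inl a) t" using 2 t' by auto
        ultimately show ?thesis unfolding left_nbhd_def by blast
      qed
    next
      case t': (Inr t')
      have tm: "rel_less r2 ?m t'" using t t' F m2 by auto
      have "left_nbhd r2 (\<lambda>z. g2 z \<in> U) t'" using c2 U t t' F by auto
      then obtain a where a: "rel_less r2 a t'" "\<forall>z. rel_less r2 a z \<longrightarrow> (z, t') \<in> r2 \<longrightarrow> g2 z \<in> U"
        using tm unfolding left_nbhd_def by blast
      show ?thesis
      proof (cases "a = ?m")
        case True
        have "?d u \<in> U" if "rel_less q (Inl ?M) u" "(u, t) \<in> q" for u
        proof (cases u)
          case (Inl u')
          then show ?thesis using that M1 L1(3,5) by simp blast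
        next
          case (Inr u')
          then show ?thesis using that t' a(2) True m2 by auto
        qed
        moreover have "rel_less q (Inl ?M) t" using t' t F M1 by auto
        ultimately show ?thesis unfolding left_nbhd_def by blast
      next
        case False
        have "?d u \<in> U" if "rel_less q (Inr a) u" "(u, t) \<in> q" for u
          using that a t' by (cases u) auto
        moreover have "rel_less q (Inr a) t" using a t' False tm by auto
        ultimately show ?thesis unfolding left_nbhd_def by blast
      qed
    qed
    show "right_nbhd q (\<lambda>z. ?d z \<in> U) t"
    proof (cases t)
      case t': (Inl t')
      show ?thesis
      proof (cases "t' = ?M")
        case True
        have "g2 ?m \<in> U" using t t' True e1 e2 by auto
        then have "right_nbhd r2 (\<lambda>z. g2 z \<in> U) ?m" using c2 U m2 by auto
        moreover have "rel_less r2 ?m (max_of r2)" using m2 M2 ne2 by auto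
        ultimately obtain a where a: "rel_less r2 ?m a"
          "\<forall>z. rel_less r2 z a \<longrightarrow> (?m, z) \<in> r2 \<longrightarrow> g2 z \<in> U"
          unfolding right_nbhd_def by blast
        have aF: "a \<in> Field r2" using a L2(5) by blast
        have "?d u \<in> U" if "rel_less q u (Inr a)" "(t, u) \<in> q" for u
        proof (cases u)
          case (Inl u')
          then have "u' = ?M" using that M1 L1(3,5) t' True by auto
          then show ?thesis using t t' Inl True by simp
        next
          case (Inr u')
          then show ?thesis using that t' a(2) m2 by auto
        qed
        moreover have "rel_less q t (Inr a)" using t' t F a aF by auto
        ultimately show ?thesis unfolding right_nbhd_def by blast
      next
        case False
        then have "rel_less r1 t' ?M" using t t' F M1 by auto
        moreover have "right_nbhd r1 (\<lambda>z. g1 z \<in> U) t'" using c1 U t t' F by auto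
        ultimately obtain a where a: "rel_less r1 t' a"
          "\<forall>z. rel_less r1 z a \<longrightarrow> (t', z) \<in> r1 \<longrightarrow> g1 z \<in> U"
          unfolding right_nbhd_def by blast
        have "?d u \<in> U" if "rel_less q u (Inl a)" "(t, u) \<in> q" for u
          using that a t' by (cases u) auto
        moreover have "rel_less q t (Inl a)" using a t' by auto
        ultimately show ?thesis unfolding right_nbhd_def by blast
      qed
    next
      case t': (Inr t')
      have tm: "t' \<noteq> ?m" using t t' F by auto
      have "right_nbhd r2 (\<lambda>z. g2 z \<in> U) t'" using c2 U t t' F by auto
      then consider "\<forall>a. \<not> rel_less r2 t' a"
        | a where "rel_less r2 t' a" "\<forall>z. rel_less r2 z a \<longrightarrow> (t', z) \<in> r2 \<longrightarrow> g2 z \<in> U"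
        unfolding right_nbhd_def by blast
      then show ?thesis
      proof cases
        case 1
        have "\<not> rel_less q t u" for u using 1 t' by (cases u) auto
        then show ?thesis unfolding right_nbhd_def by blast
      next
        case 2
        have "?d u \<in> U" if "rel_less q u (Inr a)" "(t, u) \<in> q" for u
          using that 2 t' by (cases u) auto
        moreover have "rel_less q t (Inr a)" using 2 t' tm min2 by auto
        ultimately show ?thesis unfolding right_nbhd_def by blast
      qed
    qed
  qed
  moreover have "big_interval q" using lin dn oc mn mx unfolding big_interval_def by blast
  ultimately have "big_path X q ?d x z"
    unfolding big_path_def min_of_eq[OF lin mn] max_of_eq[OF lin mx] using e1 e2 by simp
  moreover have "?d ` Field q \<subseteq> A" using F p1(2) p2(2) by auto
  ultimately show ?thesis by (rule joined_withinI)
qed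

lemma joined_within_trans:
  assumes "joined_within X A x y" "joined_within X A y z"
  shows "joined_within X A x z"
  using assms by (elim joined_withinE) (rule joined_within_append)

section \<open>Compactness, first hits and last approaches\<close>

lemma compact_space_order_topology_of:
  assumes bi: "big_interval r"
  shows "compact_space (order_topology_of r)"
  unfolding compact_space_def compactin_def topspace_order_topology_of
proof (intro conjI allI impI subset_refl)
  have lin: "Linear_order r" and dn: "dense_rel r" and oc: "order_complete_rel r"
    and m: "min_of r \<in> Field r" "\<And>t. t \<in> Field r \<Longrightarrow> (min_of r, t) \<in> r"
    and M: "max_of r \<in> Field r" "\<And>t. t \<in> Field r \<Longrightarrow> (t, max_of r) \<in> r"
    by (rule big_intervalE[OF bi]; blast)+
  note L = linear_rel_facts[OF lin]
  fix \<U> assume \<U>: "(\<forall>U \<in> \<U>. openin (order_topology_of r) U) \<and> Field r \<subseteq> \<Union>\<U>"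
  \<comment> \<open>The supremum of the points up to which finitely many members suffice is the maximum.\<close>
  let ?A = "{t \<in> Field r. \<exists>\<F>. finite \<F> \<and> \<F> \<subseteq> \<U> \<and> {z. (z, t) \<in> r} \<subseteq> \<Union>\<F>}"
  have mA: "min_of r \<in> ?A"
  proof -
    obtain U where "U \<in> \<U>" "min_of r \<in> U" using \<U> m by blast
    moreover have "{z. (z, min_of r) \<in> r} \<subseteq> {min_of r}" using m L(3,5) by blast
    ultimately show ?thesis using m by (intro CollectI conjI exI[of _ "{U}"]) auto
  qed
  have "?A \<subseteq> Field r" by blast
  moreover have "\<forall>s \<in> ?A. (s, max_of r) \<in> r" using M by blast
  ultimately obtain u where u: "is_supremum r ?A u"
    using oc mA M(1) unfolding order_complete_rel_def by (metis (no_types, lifting) empty_iff)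
  have uF: "u \<in> Field r" and ub: "\<And>s. s \<in> ?A \<Longrightarrow> (s, u) \<in> r"
    and least: "\<And>v. v \<in> Field r \<Longrightarrow> \<forall>s \<in> ?A. (s, v) \<in> r \<Longrightarrow> (u, v) \<in> r"
    using u unfolding is_supremum_def by blast+
  obtain U where U: "U \<in> \<U>" "u \<in> U" using \<U> uF by blast
  then have nb: "left_nbhd r (\<lambda>z. z \<in> U) u" "right_nbhd r (\<lambda>z. z \<in> U) u"
    using \<U> openin_order_topology_of[OF lin] by blast+
  have ext: "v \<in> ?A" if t: "t \<in> ?A" and v: "v \<in> Field r"
    "\<And>z. rel_less r t z \<Longrightarrow> (z, v) \<in> r \<Longrightarrow> z \<in> U" for t v
  proof -
    obtain \<F> where F: "finite \<F>" "\<F> \<subseteq> \<U>" "{z. (z, t) \<in> r} \<subseteq> \<Union>\<F>" using t by blast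
    have "z \<in> \<Union>(insert U \<F>)" if "(z, v) \<in> r" for z
    proof (cases "(z, t) \<in> r")
      case False
      then have "rel_less r t z" using L(1)[of t] L(4)[of t z] L(5)[OF that] t by blast
      then show ?thesis using v(2) that by blast
    qed (use F in auto)
    then show ?thesis using F U(1) v(1) by (intro CollectI conjI exI[of _ "insert U \<F>"]) auto
  qed
  have uA: "u \<in> ?A"
  proof (cases "\<forall>a. \<not> rel_less r a u")
    case True
    then have "u = min_of r" using m(2)[OF uF] by blast
    then show ?thesis using mA by simp
  next
    case False
    then obtain a where a: "rel_less r a u" "\<forall>z. rel_less r a z \<longrightarrow> (z, u) \<in> r \<longrightarrow> z \<in> U"
      using nb(1) unfolding left_nbhd_def by blast
    then have aF: "a \<in> Field r" using L(5) by blast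
    have "(u, a) \<notin> r" using a(1) L(3) by blast
    then obtain t where t: "t \<in> ?A" "(t, a) \<notin> r" using least[OF aF] by blast
    then have at: "(a, t) \<in> r" using L(4)[of a t] aF by blast
    have "z \<in> U" if z: "rel_less r t z" "(z, u) \<in> r" for z
    proof -
      have "rel_less r a z" using at z(1) L(2)[of a t z] L(3)[of a t] by blast
      then show ?thesis using a(2) z(2) by blast
    qed
    then show ?thesis using ext[OF t(1) uF] by blast
  qed
  have "u = max_of r"
  proof (rule ccontr)
    assume "u \<noteq> max_of r"
    then have "rel_less r u (max_of r)" using M uF by blast
    then obtain b where b: "rel_less r u b" "\<forall>z. rel_less r z b \<longrightarrow> (u, z) \<in> r \<longrightarrow> z \<in> U"
      using nb(2) unfolding right_nbhd_def by blast
    then obtain c where c: "rel_less r u c" "rel_less r c b" using dn unfolding dense_rel_def by blast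
    have "z \<in> U" if z: "rel_less r u z" "(z, c) \<in> r" for z
    proof -
      have "rel_less r z b" using z c L(2,3) by blast
      then show ?thesis using b z by blast
    qed
    moreover have "c \<in> Field r" using c L(5) by blast
    ultimately have "c \<in> ?A" using ext[OF uA] by blast
    then have "(c, u) \<in> r" by (rule ub)
    then show False using c(1) L(3) by blast
  qed
  then obtain \<F> where "finite \<F>" "\<F> \<subseteq> \<U>" "{z. (z, max_of r) \<in> r} \<subseteq> \<Union>\<F>" using uA by blast
  then show "\<exists>\<F>. finite \<F> \<and> \<F> \<subseteq> \<U> \<and> Field r \<subseteq> \<Union>\<F>" using M by blast
qed

lemma compactin_big_path_image:
  assumes "big_path X r \<gamma> x y"
  shows "compactin X (\<gamma> ` Field r)"
proof -
  have "compact_space (order_topology_of r)" "continuous_map (order_topology_of r) X \<gamma>"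
    using assms compact_space_order_topology_of by (auto simp: big_path_def)
  then show ?thesis using image_compactin unfolding compact_space_def topspace_order_topology_of by blast
qed

text \<open>
  The path is frozen at \<open>a\<close> once it has taken that value; before, it remains in the component of \<open>x\<close>
  in \<open>A - {a}\<close>.
\<close>
lemma joined_within_first_hit:
  assumes xa: "joined_within X A x a" and ne: "x \<noteq> a"
  shows "joined_within X (insert a {y. joined_within X (A - {a}) x y}) x a"
proof -
  obtain r :: "'a set list set rel" and \<gamma> where bp: "big_path X r \<gamma> x a" "\<gamma> ` Field r \<subseteq> A"
    using xa by (rule joined_withinE)
  have bi: "big_interval r" and e: "\<gamma> (min_of r) = x" "\<gamma> (max_of r) = a"
    using bp by (auto simp: big_path_def)
  have lin: "Linear_order r"
    and m: "min_of r \<in> Field r" "\<And>t. t \<in> Field r \<Longrightarrow> (min_of r, t) \<in> r"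
    and M: "max_of r \<in> Field r" "\<And>t. t \<in> Field r \<Longrightarrow> (t, max_of r) \<in> r"
    by (rule big_intervalE[OF bi]; blast)+
  note L = linear_rel_facts[OF lin]
  let ?Z = "{t. \<exists>s. (s, t) \<in> r \<and> \<gamma> s = a}"
  let ?d = "\<lambda>t. if t \<in> ?Z then a else \<gamma> t"
  have "big_path X r ?d x a"
  proof (rule big_path_stop[OF bp(1)])
    show "max_of r \<in> ?Z" using M e by blast
    show "?Z \<subseteq> Field r" using L(5) by blast
    show "t \<in> ?Z" if "s \<in> ?Z" "(s, t) \<in> r" for s t using that L(2) by blast
    show "\<exists>s \<in> ?Z. (s, t) \<in> r \<and> \<gamma> s = a" if "t \<in> ?Z" for t using that L(1,5) by blast
  qed
  moreover have "?d t \<in> insert a {y. joined_within X (A - {a}) x y}" if t: "t \<in> Field r" for t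
  proof (cases "t \<in> ?Z")
    case False
    have "joined_within X (\<gamma> ` {z. (min_of r, z) \<in> r \<and> (z, t) \<in> r}) x (\<gamma> t)"
      using joined_within_segment[OF bp(1) m(2)[OF t]] e by simp
    moreover have "\<gamma> ` {z. (min_of r, z) \<in> r \<and> (z, t) \<in> r} \<subseteq> A - {a}"
      using False bp(2) L(5) by blast
    ultimately show ?thesis using False joined_within_mono by fastforce
  qed simp
  ultimately show ?thesis by (intro joined_withinI) blast+
qed

text \<open>
  If \<open>{x}\<close> is closed, a path from another point to \<open>x\<close> meets every neighbourhood of \<open>x\<close> in a
  point \<open>w\<close>, distinct from \<open>x\<close>, after which it does not leave the neighbourhood until its first arrival at \<open>x\<close>.
\<close>
lemma big_path_last_approach:
  assumes bp: "big_path X r \<gamma> p x" and px: "p \<noteq> x"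
    and T1: "openin X (topspace X - {x})" and U: "openin X U" "x \<in> U"
  obtains w where "w \<in> \<gamma> ` Field r" "w \<noteq> x" "joined_within X U w x"
proof -
  have bi: "big_interval r" and co: "continuous_map (order_topology_of r) X \<gamma>"
    and e: "\<gamma> (min_of r) = p" "\<gamma> (max_of r) = x"
    using bp by (auto simp: big_path_def)
  have lin: "Linear_order r" and dn: "dense_rel r" and oc: "order_complete_rel r"
    and m: "min_of r \<in> Field r" "\<And>t. t \<in> Field r \<Longrightarrow> (min_of r, t) \<in> r"
    and M: "max_of r \<in> Field r" "\<And>t. t \<in> Field r \<Longrightarrow> (t, max_of r) \<in> r"
    by (rule big_intervalE[OF bi]; blast)+
  note L = linear_rel_facts[OF lin]
  note c = co[unfolded continuous_map_order_topology_of[OF lin]]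
  \<comment> \<open>The time \<open>u\<close> of first arrival at \<open>x\<close> is the supremum of the times before which \<open>x\<close> is avoided.\<close>
  let ?A = "{t \<in> Field r. \<forall>s. (s, t) \<in> r \<longrightarrow> \<gamma> s \<noteq> x}"
  have mA: "min_of r \<in> ?A"
  proof -
    have "s = min_of r" if "(s, min_of r) \<in> r" for s using that m L(3,5) by blast
    then show ?thesis using e px m(1) by blast
  qed
  have "?A \<subseteq> Field r" by blast
  moreover have "\<forall>s \<in> ?A. (s, max_of r) \<in> r" using M by blast
  ultimately obtain u where u: "is_supremum r ?A u"
    using oc mA M(1) unfolding order_complete_rel_def by (metis (no_types, lifting) empty_iff)
  have uF: "u \<in> Field r" and ub: "\<And>s. s \<in> ?A \<Longrightarrow> (s, u) \<in> r"
    and least: "\<And>v. v \<in> Field r \<Longrightarrow> \<forall>s \<in> ?A. (s, v) \<in> r \<Longrightarrow> (u, v) \<in> r"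
    using u unfolding is_supremum_def by blast+
  have below: "\<gamma> z \<noteq> x" if z: "rel_less r z u" for z
  proof -
    have zF: "z \<in> Field r" "(u, z) \<notin> r" using z L(3,5) by blast+
    then obtain t where t: "t \<in> ?A" "(t, z) \<notin> r" using least by blast
    then have "(z, t) \<in> r" using zF L(4) by blast
    then show ?thesis using t by blast
  qed
  have ux: "\<gamma> u = x"
  proof (rule ccontr)
    assume ne: "\<gamma> u \<noteq> x"
    then have "rel_less r u (max_of r)" using M uF e by blast
    moreover have "right_nbhd r (\<lambda>z. \<gamma> z \<in> topspace X - {x}) u" using ne c T1 uF by blast
    ultimately obtain b where b: "rel_less r u b"
      "\<forall>z. rel_less r z b \<longrightarrow> (u, z) \<in> r \<longrightarrow> \<gamma> z \<in> topspace X - {x}"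
      unfolding right_nbhd_def by blast
    obtain d where d: "rel_less r u d" "rel_less r d b" using b dn unfolding dense_rel_def by blast
    have "\<gamma> z \<noteq> x" if z: "(z, d) \<in> r" for z
    proof (cases "(u, z) \<in> r")
      case True
      moreover have "rel_less r z b" using z d L(2,3) by blast
      ultimately show ?thesis using b by blast
    next
      case False
      then have "rel_less r z u" using L(1,4,5) uF z by blast
      then show ?thesis using below by blast
    qed
    then have "d \<in> ?A" using d L(5) by blast
    then show False using ub d L(3) by blast
  qed
  have "rel_less r (min_of r) u" using m(2)[OF uF] ux e px by auto
  moreover have "left_nbhd r (\<lambda>z. \<gamma> z \<in> U) u" using c U uF ux by blast
  ultimately obtain a where a: "rel_less r a u" "\<forall>z. rel_less r a z \<longrightarrow> (z, u) \<in> r \<longrightarrow> \<gamma> z \<in> U"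
    unfolding left_nbhd_def by blast
  obtain t where t: "rel_less r a t" "rel_less r t u" using a dn unfolding dense_rel_def by blast
  have "joined_within X (\<gamma> ` {z. (t, z) \<in> r \<and> (z, u) \<in> r}) (\<gamma> t) x"
    using joined_within_segment[OF bp] t ux by blast
  moreover have "\<gamma> z \<in> U" if z: "(t, z) \<in> r" "(z, u) \<in> r" for z
  proof -
    have "rel_less r a z" using z t L(2,3) by blast
    then show ?thesis using a z by blast
  qed
  ultimately have "joined_within X U (\<gamma> t) x" using joined_within_mono by (metis (no_types, lifting) image_subsetI mem_Collect_eq)
  moreover have "t \<in> Field r" using t L(5) by blast
  ultimately show thesis using that below[OF t(2)] by blast
qed

section \<open>Separation by pairs of points\<close>

lemma big_path_connectedin_iff:
  "big_path_connectedin X S \<longleftrightarrow> S \<subseteq> topspace X \<and> (\<forall>x \<in> S. \<forall>y \<in> S. joined_within X S x y)"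
  unfolding big_path_connectedin_def big_path_connected_space_def joined_within_def by auto

text \<open>
  The pair \<open>{a, b}\<close> separates \<open>c\<close> from \<open>d\<close>: these lie in distinct big-path-connected components of the
  complement of \<open>{a, b}\<close>. The relation includes that \<open>a\<close> and \<open>b\<close> are distinct points of the space.
\<close>
definition separates :: "'a topology \<Rightarrow> 'a \<Rightarrow> 'a \<Rightarrow> 'a \<Rightarrow> 'a \<Rightarrow> bool" where
  "separates X a b c d \<longleftrightarrow> a \<in> topspace X \<and> b \<in> topspace X \<and> a \<noteq> b \<and>
     c \<in> topspace X - {a, b} \<and> d \<in> topspace X - {a, b} \<and>
     \<not> joined_within X (topspace X - {a, b}) c d"

lemma separates_sym: "separates X a b c d \<Longrightarrow> separates X a b d c"
  unfolding separates_def using joined_within_sym by metis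

lemma separates_split:
  assumes "separates X a b c d" "e \<in> topspace X - {a, b}"
  shows "separates X a b e c \<or> separates X a b e d"
  using assms joined_within_trans[OF joined_within_sym] unfolding separates_def by metis

lemma flimsy_remove_point:
  assumes F: "two_big_path_flimsy X" and a: "a \<in> topspace X"
    and "x \<in> topspace X - {a}" "y \<in> topspace X - {a}"
  shows "joined_within X (topspace X - {a}) x y"
proof -
  have "big_path_connectedin X (topspace X - {a})"
    using F a unfolding two_big_path_flimsy_def by (auto dest: spec[of _ "{a}"])
  then show ?thesis using assms unfolding big_path_connectedin_iff by blast
qed

lemma flimsy_remove_pair:
  assumes F: "two_big_path_flimsy X" and ab: "a \<in> topspace X" "b \<in> topspace X" "a \<noteq> b"
  obtains c d where "separates X a b c d"
proof -
  have "\<not> big_path_connectedin X (topspace X - {a, b})"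
    using F ab unfolding two_big_path_flimsy_def by (auto dest: spec[of _ "{a, b}"])
  then show thesis using that ab unfolding big_path_connectedin_iff separates_def by blast
qed

lemma flimsy_ex_other:
  assumes F: "two_big_path_flimsy X"
  obtains z where "z \<in> topspace X" "z \<noteq> x"
proof -
  have "\<not> topspace X \<subseteq> {x}"
  proof
    assume "topspace X \<subseteq> {x}"
    then have "finite (topspace X)" "card (topspace X) \<le> 1"
      using finite_subset card_mono[of "{x}" "topspace X"] by auto
    then show False using F unfolding two_big_path_flimsy_def by auto
  qed
  then show thesis using that by blast
qed

text \<open>
  The point \<open>a\<close> is accessible from within each component of the complement of \<open>{a, b}\<close>; so it is
  reached from \<open>x\<close> without meeting \<open>b\<close> or any set \<open>Q\<close> that contains neither \<open>a\<close> nor a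
  point of the component of \<open>x\<close>.
\<close>
lemma joined_within_puncture:
  assumes F: "two_big_path_flimsy X" and ab: "a \<in> topspace X" "b \<in> topspace X" "a \<noteq> b"
    and x: "x \<in> topspace X - {a, b}"
    and Q: "a \<notin> Q" "\<And>y. y \<in> Q \<Longrightarrow> \<not> joined_within X (topspace X - {a, b}) x y"
  shows "joined_within X (topspace X - {b} - Q) x a"
proof -
  have "joined_within X (topspace X - {b}) x a"
    using flimsy_remove_point[OF F ab(2)] x ab by blast
  then have "joined_within X (insert a {y. joined_within X (topspace X - {b} - {a}) x y}) x a"
    using x by (intro joined_within_first_hit) auto
  moreover have "topspace X - {b} - {a} = topspace X - {a, b}" by auto
  moreover have "insert a {y. joined_within X (topspace X - {a, b}) x y} \<subseteq> topspace X - {b} - Q"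
    using ab Q joined_within_in(2)[of X "topspace X - {a, b}" x] by blast
  ultimately show ?thesis using joined_within_mono by metis
qed

text \<open>
  Otherwise \<open>a\<close> and \<open>b\<close> are in one component of the complement of \<open>{c, d}\<close>. Any point \<open>y\<close> of another
  component is joined to both \<open>c\<close> and \<open>d\<close> without meeting \<open>a\<close> or \<open>b\<close>, so \<open>c\<close> and \<open>d\<close> are not separated.
\<close>
lemma separates_swap:
  assumes F: "two_big_path_flimsy X" and s: "separates X a b c d"
  shows "separates X c d a b"
proof -
  have ab: "a \<in> topspace X" "b \<in> topspace X" "a \<noteq> b" "c \<in> topspace X" "d \<in> topspace X"
    "c \<noteq> a" "c \<noteq> b" "d \<noteq> a" "d \<noteq> b" and nj: "\<not> joined_within X (topspace X - {a, b}) c d"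
    using s unfolding separates_def by auto
  then have cd: "c \<noteq> d" using joined_within_refl by (metis Diff_iff insertE singletonD)
  have "\<not> joined_within X (topspace X - {c, d}) a b"
  proof
    assume j: "joined_within X (topspace X - {c, d}) a b"
    obtain e f where ef: "separates X c d e f" using flimsy_remove_pair[OF F] ab cd by metis
    obtain y where y: "separates X c d y a"
      using separates_split[OF ef, of a] ab separates_sym by fast
    have y': "y \<in> topspace X - {c, d}" using y unfolding separates_def by blast
    have ya: "\<not> joined_within X (topspace X - {c, d}) y z" if "z \<in> {a, b}" for z
      using that y j joined_within_trans joined_within_sym unfolding separates_def by fast
    have "joined_within X (topspace X - {d} - {a, b}) y c"
      using joined_within_puncture[OF F, of c d y "{a, b}"] ab cd y' ya by blast
    moreover have "joined_within X (topspace X - {c} - {a, b}) y d"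
      using joined_within_puncture[OF F, of d c y "{a, b}"] ab cd y' ya by (simp add: insert_commute)
    ultimately have "joined_within X (topspace X - {a, b}) y c" "joined_within X (topspace X - {a, b}) y d"
      by (auto elim!: joined_within_mono)
    then show False using nj joined_within_sym joined_within_trans by metis
  qed
  then show ?thesis using ab cd unfolding separates_def by auto
qed

text \<open>
  The component of \<open>e\<close> connects \<open>a\<close> with \<open>b\<close> while avoiding \<open>c\<close> and \<open>d\<close>, contrary to the fact that
  \<open>{c, d}\<close> separates \<open>a\<close> from \<open>b\<close>.
\<close>
lemma not_three_separated:
  assumes F: "two_big_path_flimsy X"
    and s: "separates X a b c d" "separates X a b c e" "separates X a b d e"
  shows False
proof -
  have ab: "a \<in> topspace X" "b \<in> topspace X" "a \<noteq> b" "e \<in> topspace X - {a, b}"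
    "c \<noteq> a" "c \<noteq> b" "d \<noteq> a" "d \<noteq> b"
    using s unfolding separates_def by auto
  have Q: "\<not> joined_within X (topspace X - {a, b}) e y" if "y \<in> {c, d}" for y
    using that s(2,3)[THEN separates_sym] unfolding separates_def by auto
  have "joined_within X (topspace X - {b} - {c, d}) e a"
    using joined_within_puncture[OF F, of a b e "{c, d}"] ab Q by blast
  moreover have "joined_within X (topspace X - {a} - {c, d}) e b"
    using joined_within_puncture[OF F, of b a e "{c, d}"] ab Q by (simp add: insert_commute)
  ultimately have "joined_within X (topspace X - {c, d}) e a" "joined_within X (topspace X - {c, d}) e b"
    by (auto elim!: joined_within_mono)
  then have "joined_within X (topspace X - {c, d}) a b"
    using joined_within_sym joined_within_trans by metis
  then show False using separates_swap[OF F s(1)] unfolding separates_def by blast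
qed

lemma flimsy_T1:
  assumes F: "two_big_path_flimsy X" and x: "x \<in> topspace X"
  shows "openin X (topspace X - {x})"
proof (subst openin_subopen, intro ballI)
  fix y assume y: "y \<in> topspace X - {x}"
  have "\<exists>U. openin X U \<and> y \<in> U \<and> x \<notin> U"
  proof (rule ccontr)
    assume no: "\<not> ?thesis"
    obtain c d where s: "separates X x y c d" using flimsy_remove_pair[OF F] x y by blast
    have "joined_within X (topspace X - {c, d}) y x"
      by (rule joined_within_specialization) (use x y s no in \<open>auto simp: separates_def\<close>)
    then show False
      using separates_swap[OF F s] joined_within_sym unfolding separates_def by metis
  qed
  then show "\<exists>U. openin X U \<and> y \<in> U \<and> U \<subseteq> topspace X - {x}"
    using openin_subset by (metis Diff_empty subset_Diff_insert)
qed

text \<open>A path which avoids one of two points separating its ends passes through the other one.\<close>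
lemma separates_crossing:
  assumes s: "separates X y z x w" and j: "joined_within X A x w" and z: "z \<notin> A"
  shows "y \<in> A"
proof (rule ccontr)
  assume "y \<notin> A"
  obtain r :: "'a set list set rel" and \<gamma> where bp: "big_path X r \<gamma> x w" "\<gamma> ` Field r \<subseteq> A"
    using j by (rule joined_withinE)
  then have "\<gamma> ` Field r \<subseteq> topspace X - {y, z}"
    using big_path_endpoints(3)[OF bp(1)] z \<open>y \<notin> A\<close> by blast
  then show False using s joined_withinI[OF bp(1)] unfolding separates_def by blast
qed

section \<open>The component topology\<close>

lemma topspace_component_topology: "topspace (component_topology X) = topspace X"
proof -
  have "C \<subseteq> topspace X" if "C \<in> big_path_components_of (subtopology X A)" for C A
    using that joined_within_in(4)[of X A]
    unfolding big_path_components_of_def quotient_def joined_within_def by auto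
  then show ?thesis unfolding component_topology_def topology_generated_by_topspace by auto
qed

lemma components_remove_pair:
  "C \<in> big_path_components_of (subtopology X (topspace X - {a, b})) \<longleftrightarrow>
    (\<exists>p \<in> topspace X - {a, b}. C = {y. joined_within X (topspace X - {a, b}) p y})"
  unfolding big_path_components_of_def quotient_def joined_within_def by auto

lemma openin_component_topology:
  assumes "a \<in> topspace X" "b \<in> topspace X" "a \<noteq> b" "p \<in> topspace X - {a, b}"
  shows "openin (component_topology X) {y. joined_within X (topspace X - {a, b}) p y}"
proof -
  have "{y. joined_within X (topspace X - {a, b}) p y}
      \<in> big_path_components_of (subtopology X (topspace X - {a, b}))"
    unfolding components_remove_pair using assms(4) by blast
  then show ?thesis
    unfolding component_topology_def using assms(1-3)
    by (intro topology_generated_by_Basis insertI2 CollectI) metis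
qed

lemma finer_component_topology:
  assumes F: "two_big_path_flimsy X"
  shows "finer_topology (component_topology X) X"
  unfolding finer_topology_def
proof (intro conjI allI impI)
  show "topspace (component_topology X) = topspace X" by (rule topspace_component_topology)
  fix U assume U: "openin X U"
  show "openin (component_topology X) U"
  proof (subst openin_subopen, intro ballI)
    fix x assume x: "x \<in> U"
    have xV: "x \<in> topspace X" using U x openin_subset by blast
    obtain z where z: "z \<in> topspace X" "z \<noteq> x" using flimsy_ex_other[OF F] by blast
    \<comment> \<open>With \<open>z\<close> removed, \<open>x\<close> has two sides; \<open>U\<close> contains a path from \<open>x\<close> to some \<open>w\<close> on the side of \<open>p\<close>.\<close>
    have approach: "\<exists>w. separates X x z w q \<and> joined_within X (U - {z}) x w"
      if s: "separates X x z p q" for p q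
    proof -
      have p: "p \<in> topspace X - {x, z}" and q: "q \<in> topspace X - {x, z}" using s unfolding separates_def by auto
      let ?P = "{y. joined_within X (topspace X - {x, z}) p y}"
      have "joined_within X (topspace X - {z}) p x"
        using flimsy_remove_point[OF F z(1)] p xV z by blast
      then have "joined_within X (insert x {y. joined_within X (topspace X - {z} - {x}) p y}) p x"
        using p by (intro joined_within_first_hit) auto
      then have "joined_within X (insert x ?P) p x"
        by (metis (no_types, lifting) Diff_insert)
      then obtain r :: "'a set list set rel" and \<gamma>
        where bp: "big_path X r \<gamma> p x" "\<gamma> ` Field r \<subseteq> insert x ?P" by (rule joined_withinE)
      have U': "openin X (U \<inter> (topspace X - {z}))" using U flimsy_T1[OF F z(1)] by blast
      obtain w where w: "w \<in> \<gamma> ` Field r" "w \<noteq> x" "joined_within X (U \<inter> (topspace X - {z})) w x"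
        using big_path_last_approach[OF bp(1) _ flimsy_T1[OF F xV] U'] p x xV z by blast
      have "joined_within X (topspace X - {x, z}) p w" using w bp(2) by blast
      then have "separates X x z w q"
        using s joined_within_trans joined_within_in(2) unfolding separates_def by meson
      moreover have "joined_within X (U - {z}) x w"
        using w(3) by (rule joined_within_mono[OF joined_within_sym]) blast
      ultimately show ?thesis by blast
    qed
    obtain p q where "separates X x z p q" using flimsy_remove_pair[OF F xV z(1)] z by blast
    then obtain w where w: "separates X x z w q" "joined_within X (U - {z}) x w" using approach by blast
    obtain w' where w': "separates X x z w' w" "joined_within X (U - {z}) x w'"
      using approach separates_sym[OF w(1)] by blast
    have s: "separates X w w' x z" using separates_swap[OF F separates_sym[OF w'(1)]] .
    let ?W = "{y. joined_within X (topspace X - {w, w'}) x y}"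
    have "?W \<subseteq> U"
    proof
      fix y assume y: "y \<in> ?W"
      have "separates X w w' y z"
        using s y joined_within_trans joined_within_in(2) unfolding separates_def by (metis mem_Collect_eq)
      then have yz: "separates X y z w w'" by (rule separates_swap[OF F])
      \<comment> \<open>Of \<open>w\<close> and \<open>w'\<close>, separated by \<open>{y, z}\<close>, one is separated from \<open>x\<close>: the path to it crosses \<open>y\<close>.\<close>
      show "y \<in> U"
      proof (cases "y = x")
        case False
        then have "x \<in> topspace X - {y, z}" using xV z by blast
        then have "separates X y z x w \<or> separates X y z x w'" by (rule separates_split[OF yz])
        then have "y \<in> U - {z}" using separates_crossing w(2) w'(2) by (metis DiffE singletonI)
        then show ?thesis by blast
      qed (use x in simp)
    qed
    moreover have "openin (component_topology X) ?W"
      by (rule openin_component_topology) (use s in \<open>auto simp: separates_def\<close>)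
    moreover have "x \<in> ?W"
      unfolding mem_Collect_eq
      by (rule joined_within_refl) (use s in \<open>auto simp: separates_def\<close>)
    ultimately show "\<exists>T. openin (component_topology X) T \<and> x \<in> T \<and> T \<subseteq> U" by blast
  qed
qed

lemma continuous_map_id_finer: "finer_topology Y X \<Longrightarrow> continuous_map Y X id"
  unfolding finer_topology_def by (metis topology_finer_continuous_id)

lemma big_path_finer:
  assumes "finer_topology Y X" "big_path Y r \<gamma> x y"
  shows "big_path X r \<gamma> x y"
proof -
  have "continuous_map (order_topology_of r) X (id \<circ> \<gamma>)"
    using assms(2) continuous_map_compose continuous_map_id_finer[OF assms(1)]
    unfolding big_path_def by blast
  then show ?thesis using assms(2) unfolding big_path_def by simp
qed

text \<open>
  A big path of the component topology is one of \<open>X\<close>, whose topology is coarser. Conversely, continuity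
  with respect to the component topology holds as the complement of a pair is open: near a
  time at which it is in a component of this complement, a big path of \<open>X\<close> stays in the complement, hence in the component.
\<close>
lemma big_path_component_topology:
  fixes r :: "'l rel"
  assumes F: "two_big_path_flimsy X"
  shows "big_path X r \<gamma> x y \<longleftrightarrow> big_path (component_topology X) r \<gamma> x y"
proof
  show "big_path X r \<gamma> x y" if "big_path (component_topology X) r \<gamma> x y"
    using big_path_finer[OF finer_component_topology[OF F] that] .
next
  assume bp: "big_path X r \<gamma> x y"
  have bi: "big_interval r" and co: "continuous_map (order_topology_of r) X \<gamma>"
    using bp by (auto simp: big_path_def)
  have lin: "Linear_order r" by (rule big_intervalE[OF bi])
  note L = linear_rel_facts[OF lin]
  note c = co[unfolded continuous_map_order_topology_of[OF lin]]
  have "openin (order_topology_of r) {t \<in> Field r. joined_within X (topspace X - {a, b}) p (\<gamma> t)}"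
    if ab: "a \<in> topspace X" "b \<in> topspace X" for a b p
  proof -
    let ?V = "topspace X - {a, b}"
    have "openin X ((topspace X - {a}) \<inter> (topspace X - {b}))"
      using ab by (intro openin_Int flimsy_T1[OF F])
    moreover have "(topspace X - {a}) \<inter> (topspace X - {b}) = ?V" by blast
    ultimately have V: "openin X ?V" by simp
    have near: "joined_within X ?V p (\<gamma> z)"
      if "joined_within X ?V p (\<gamma> t)" "joined_within X ?V (\<gamma> t) (\<gamma> z) \<or> joined_within X ?V (\<gamma> z) (\<gamma> t)" for t z
      using that joined_within_trans joined_within_sym by metis
    have left: "left_nbhd r (\<lambda>z. joined_within X ?V p (\<gamma> z)) t"
      and right: "right_nbhd r (\<lambda>z. joined_within X ?V p (\<gamma> z)) t"
      if t: "t \<in> Field r" "joined_within X ?V p (\<gamma> t)" for t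
    proof -
      have nb: "left_nbhd r (\<lambda>z. \<gamma> z \<in> ?V) t" "right_nbhd r (\<lambda>z. \<gamma> z \<in> ?V) t"
        using c V t joined_within_in(2)[OF t(2)] by blast+
      show "left_nbhd r (\<lambda>z. joined_within X ?V p (\<gamma> z)) t"
      proof (cases "\<forall>a. \<not> rel_less r a t")
        case False
        then obtain u where u: "rel_less r u t" "\<forall>z. rel_less r u z \<longrightarrow> (z, t) \<in> r \<longrightarrow> \<gamma> z \<in> ?V"
          using nb(1) unfolding left_nbhd_def by blast
        have "joined_within X ?V p (\<gamma> z)" if z: "rel_less r u z" "(z, t) \<in> r" for z
        proof -
          have "rel_less r u v" if "(z, v) \<in> r" for v using z(1) that L(2)[of u z v] L(3)[of u z] by blast
          then have "\<gamma> ` {v. (z, v) \<in> r \<and> (v, t) \<in> r} \<subseteq> ?V" using u(2) by blast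
          then show ?thesis
            using near[OF t(2)] joined_within_mono[OF joined_within_segment[OF bp z(2)]] by blast
        qed
        then show ?thesis using u(1) unfolding left_nbhd_def by blast
      qed (simp add: left_nbhd_def)
      show "right_nbhd r (\<lambda>z. joined_within X ?V p (\<gamma> z)) t"
      proof (cases "\<forall>a. \<not> rel_less r t a")
        case False
        then obtain u where u: "rel_less r t u" "\<forall>z. rel_less r z u \<longrightarrow> (t, z) \<in> r \<longrightarrow> \<gamma> z \<in> ?V"
          using nb(2) unfolding right_nbhd_def by blast
        have "joined_within X ?V p (\<gamma> z)" if z: "rel_less r z u" "(t, z) \<in> r" for z
        proof -
          have "rel_less r v u" if "(v, z) \<in> r" for v using z(1) that L(2)[of v z u] L(3)[of z u] by blast
          then have "\<gamma> ` {v. (t, v) \<in> r \<and> (v, z) \<in> r} \<subseteq> ?V" using u(2) by blast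
          then show ?thesis
            using near[OF t(2)] joined_within_mono[OF joined_within_segment[OF bp z(2)]] by blast
        qed
        then show ?thesis using u(1) unfolding right_nbhd_def by blast
      qed (simp add: right_nbhd_def)
    qed
    have restrict: "left_nbhd r (\<lambda>z. z \<in> {t \<in> Field r. P t}) t \<longleftrightarrow> left_nbhd r P t"
      "right_nbhd r (\<lambda>z. z \<in> {t \<in> Field r. P t}) t \<longleftrightarrow> right_nbhd r P t" for P t
      using L(5) unfolding left_nbhd_def right_nbhd_def mem_Collect_eq by meson+
    show ?thesis
      unfolding openin_order_topology_of[OF lin] restrict using left right by blast
  qed
  note comp = this
  have "continuous_map (order_topology_of r) (component_topology X) \<gamma>"
    unfolding component_topology_def
  proof (rule continuous_on_generated_topo)
    have sub: "\<gamma> ` Field r \<subseteq> topspace X" using big_path_endpoints[OF bp] by blast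
    show "openin (order_topology_of r) (\<gamma> -` U \<inter> topspace (order_topology_of r))"
      if U: "U \<in> insert (topspace X)
        {C. \<exists>x \<in> topspace X. \<exists>y \<in> topspace X. x \<noteq> y \<and>
           C \<in> big_path_components_of (subtopology X (topspace X - {x, y}))}" for U
    proof -
      consider "U = topspace X" | a b p where "a \<in> topspace X" "b \<in> topspace X"
        "U = {y. joined_within X (topspace X - {a, b}) p y}"
        using U unfolding components_remove_pair by auto
      then show ?thesis
      proof cases
        case 1
        then have "\<gamma> -` U \<inter> topspace (order_topology_of r) = topspace (order_topology_of r)"
          using sub unfolding topspace_order_topology_of by blast
        then show ?thesis by simp
      next
        case 2
        have "\<gamma> -` U \<inter> topspace (order_topology_of r) =
            {t \<in> Field r. joined_within X (topspace X - {a, b}) p (\<gamma> t)}"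
          unfolding 2(3) topspace_order_topology_of by blast
        then show ?thesis using comp[OF 2(1,2)] by simp
      qed
    qed
    show "\<gamma> ` topspace (order_topology_of r) \<subseteq> \<Union> (insert (topspace X)
        {C. \<exists>x \<in> topspace X. \<exists>y \<in> topspace X. x \<noteq> y \<and>
           C \<in> big_path_components_of (subtopology X (topspace X - {x, y}))})"
      using sub unfolding topspace_order_topology_of by blast
  qed
  then show "big_path (component_topology X) r \<gamma> x y" using bp unfolding big_path_def by blast
qed

lemma joined_within_component_topology:
  assumes "two_big_path_flimsy X"
  shows "joined_within (component_topology X) A x y \<longleftrightarrow> joined_within X A x y"
  unfolding joined_within_def big_path_joined_def big_path_subtopology_iff
    big_path_component_topology[OF assms] ..

lemma big_path_connectedin_component_topology:
  assumes "two_big_path_flimsy X"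
  shows "big_path_connectedin (component_topology X) S \<longleftrightarrow> big_path_connectedin X S"
  unfolding big_path_connectedin_iff joined_within_component_topology[OF assms]
    topspace_component_topology ..

lemma flimsy_component_topology:
  assumes "two_big_path_flimsy X"
  shows "two_big_path_flimsy (component_topology X)"
  using assms
  unfolding two_big_path_flimsy_def big_path_connectedin_component_topology[OF assms]
    topspace_component_topology .

lemma Hausdorff_component_topology:
  assumes F: "two_big_path_flimsy X"
  shows "Hausdorff_space (component_topology X)"
  unfolding Hausdorff_space_def topspace_component_topology
proof (intro allI impI)
  fix x y assume "x \<in> topspace X \<and> y \<in> topspace X \<and> x \<noteq> y"
  then obtain a b where "separates X x y a b" using flimsy_remove_pair[OF F] by blast
  then have s: "separates X a b x y" by (rule separates_swap[OF F])
  let ?C = "\<lambda>p. {z. joined_within X (topspace X - {a, b}) p z}"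
  have "openin (component_topology X) (?C p) \<and> p \<in> ?C p" if "p \<in> {x, y}" for p
    using that s openin_component_topology[of a X b p] joined_within_refl[of p _ X]
    unfolding separates_def by auto
  moreover have "disjnt (?C x) (?C y)"
    using s joined_within_sym joined_within_trans unfolding separates_def disjnt_iff by (metis mem_Collect_eq)
  ultimately show "\<exists>U V. openin (component_topology X) U \<and> openin (component_topology X) V \<and>
      x \<in> U \<and> y \<in> V \<and> disjnt U V" by (metis insertCI)
qed

section \<open>Compactness and uniqueness\<close>

text \<open>
  Each point other than \<open>a\<close> and \<open>b\<close> is separated by \<open>{a, b}\<close> from \<open>c\<close> or from \<open>d\<close>; so it lies on
  each path from \<open>a\<close> to \<open>b\<close> that avoids \<open>c\<close>, or on each such path that avoids \<open>d\<close>.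
\<close>
lemma compact_space_flimsy:
  assumes F: "two_big_path_flimsy X"
  shows "compact_space X"
proof -
  obtain a where a: "a \<in> topspace X" using flimsy_ex_other[OF F] by blast
  obtain b where b: "b \<in> topspace X" "b \<noteq> a" using flimsy_ex_other[OF F] by blast
  obtain c d where s: "separates X a b c d" using flimsy_remove_pair[OF F a b(1)] b by blast
  have arc: "\<exists>K. compactin X K \<and> a \<in> K \<and> b \<in> K \<and> (\<forall>y. separates X a b y d \<longrightarrow> y \<in> K)"
    if d: "d \<in> topspace X - {a, b}" for d
  proof -
    have "joined_within X (topspace X - {d}) a b"
      using flimsy_remove_point[OF F] a b d by blast
    then obtain r :: "'a set list set rel" and \<gamma>
      where bp: "big_path X r \<gamma> a b" "\<gamma> ` Field r \<subseteq> topspace X - {d}" by (rule joined_withinE)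
    have "y \<in> \<gamma> ` Field r" if "separates X a b y d" for y
      using separates_crossing[OF separates_swap[OF F that] joined_withinI[OF bp(1) subset_refl]] bp(2)
      by blast
    then show ?thesis using compactin_big_path_image[OF bp(1)] big_path_endpoints[OF bp(1)] by blast
  qed
  have cd: "c \<in> topspace X - {a, b}" "d \<in> topspace X - {a, b}" using s unfolding separates_def by auto
  obtain K where K: "compactin X K" "a \<in> K" "b \<in> K" "\<And>y. separates X a b y c \<Longrightarrow> y \<in> K"
    using arc[OF cd(1)] by blast
  obtain K' where K': "compactin X K'" "\<And>y. separates X a b y d \<Longrightarrow> y \<in> K'"
    using arc[OF cd(2)] by blast
  have "topspace X \<subseteq> K \<union> K'"
    using K K' separates_split[OF s] by blast
  then have "K \<union> K' = topspace X" using K(1) K'(1) compactin_subset_topspace by blast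
  then show ?thesis using compactin_Un[OF K(1) K'(1)] unfolding compact_space_def by simp
qed

lemma joined_within_finer:
  assumes "finer_topology Y X" "joined_within Y A x y"
  shows "joined_within X A x y"
  using assms(2) by (rule joined_withinE) (rule joined_withinI[OF big_path_finer[OF assms(1)]])

text \<open>
  Components in \<open>Y\<close> of the complement of a pair are contained in components in \<open>X\<close>. If two of them were
  contained in the same one, then, as there are only two, all of the complement would be connected in \<open>X\<close>.
\<close>
lemma component_topology_finer_eq:
  assumes FX: "two_big_path_flimsy X" and FY: "two_big_path_flimsy Y" and fin: "finer_topology Y X"
  shows "component_topology Y = component_topology X"
proof -
  have top: "topspace Y = topspace X" using fin by (simp add: finer_topology_def)
  have "joined_within Y (topspace X - {a, b}) p y"
    if ab: "a \<in> topspace X" "b \<in> topspace X" "a \<noteq> b" and j: "joined_within X (topspace X - {a, b}) p y"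
    for a b p y
  proof (rule ccontr)
    assume n: "\<not> ?thesis"
    have py: "p \<in> topspace X - {a, b}" "y \<in> topspace X - {a, b}" using joined_within_in[OF j] by auto
    have s: "separates Y a b p y" using n ab py unfolding separates_def top by blast
    obtain c d where cd: "separates X a b c d" using flimsy_remove_pair[OF FX ab] .
    have to_p: "joined_within X (topspace X - {a, b}) p e" if e: "e \<in> topspace X - {a, b}" for e
    proof -
      have "\<not> separates Y a b e p \<or> \<not> separates Y a b e y"
        using not_three_separated[OF FY] s by blast
      then have "joined_within Y (topspace X - {a, b}) e p \<or> joined_within Y (topspace X - {a, b}) e y"
        using e py ab unfolding separates_def top by blast
      then show ?thesis
        using j joined_within_finer[OF fin] joined_within_sym joined_within_trans by metis
    qed
    then show False
      using cd joined_within_sym joined_within_trans unfolding separates_def by metis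
  qed
  then have "joined_within Y (topspace X - {a, b}) = joined_within X (topspace X - {a, b})"
    if "a \<in> topspace X" "b \<in> topspace X" "a \<noteq> b" for a b
    using that joined_within_finer[OF fin] by (intro ext) blast
  then have "C \<in> big_path_components_of (subtopology Y (topspace Y - {a, b})) \<longleftrightarrow>
      C \<in> big_path_components_of (subtopology X (topspace X - {a, b}))"
    if "a \<in> topspace X" "b \<in> topspace X" "a \<noteq> b" for a b C
    using that unfolding components_remove_pair unfolding top by simp
  then have "{C. \<exists>x \<in> topspace Y. \<exists>y \<in> topspace Y. x \<noteq> y \<and>
           C \<in> big_path_components_of (subtopology Y (topspace Y - {x, y}))} =
      {C. \<exists>x \<in> topspace X. \<exists>y \<in> topspace X. x \<noteq> y \<and>
           C \<in> big_path_components_of (subtopology X (topspace X - {x, y}))}"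
    unfolding top by blast
  then show ?thesis unfolding component_topology_def top by simp
qed

lemma compact_Hausdorff_finer_eq:
  assumes K: "compact_space Z" and H: "Hausdorff_space Y" and fin: "finer_topology Z Y"
  shows "Z = Y"
proof -
  have top: "topspace Z = topspace Y" using fin by (simp add: finer_topology_def)
  have "closedin Y C" if "closedin Z C" for C
    using continuous_imp_closed_map[OF continuous_map_id_finer[OF fin] K H] that
    unfolding closed_map_def by (metis image_id id_apply)
  then have "closedin Z C \<longleftrightarrow> closedin Y C" for C
    using fin top unfolding finer_topology_def closedin_def by metis
  then show ?thesis by (simp add: topology_eq openin_closedin_eq top)
qed

theorem theorem1p5:
  fixes X :: "'a topology"
  assumes "two_big_path_flimsy X"
  shows "compact_space X \<and>
    (\<exists>!Y. finer_topology Y X \<and> Hausdorff_space Y \<and> two_big_path_flimsy Y) \<and>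
    (finer_topology (component_topology X) X \<and> Hausdorff_space (component_topology X) \<and>
      two_big_path_flimsy (component_topology X)) \<and>
    (\<forall>S. big_path_connectedin X S \<longleftrightarrow> big_path_connectedin (component_topology X) S) \<and>
    (\<forall>(r :: 'l rel) (\<gamma> :: 'l \<Rightarrow> 'a) x y.
      big_path X r \<gamma> x y \<longleftrightarrow> big_path (component_topology X) r \<gamma> x y)"
proof -
  let ?H = "component_topology X"
  have H: "finer_topology ?H X \<and> Hausdorff_space ?H \<and> two_big_path_flimsy ?H"
    using assms finer_component_topology Hausdorff_component_topology flimsy_component_topology by blast
  have "Y = ?H" if Y: "finer_topology Y X \<and> Hausdorff_space Y \<and> two_big_path_flimsy Y" for Y
  proof -
    have "?H = component_topology Y"
      using component_topology_finer_eq[OF assms] Y by simp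
    then have "finer_topology ?H Y" using finer_component_topology Y by metis
    then show ?thesis using compact_Hausdorff_finer_eq compact_space_flimsy H Y by metis
  qed
  then have "\<exists>!Y. finer_topology Y X \<and> Hausdorff_space Y \<and> two_big_path_flimsy Y" using H by blast
  then show ?thesis
    using H compact_space_flimsy[OF assms] big_path_connectedin_component_topology[OF assms]
      big_path_component_topology[OF assms] by blast
qed

end
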